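(* Let $\Phi$ be a root system with Weyl group $\mathcal{W}=\mathcal{W}(\Phi)$, let $K$ be an arbitrary field, and let $\{J,J'\}$ be a good sub-system in $\Phi$, where $J$ and $J'$ are simple systems of the subsystems $\Psi$ and $\Psi'$ of $\Phi$ respectively. Let $S^{\Psi,\Psi'}\subseteq M^{\Psi}$ be the associated $K\mathcal{W}$-submodule generated by the generalized $\Delta^*$-polytabloids, and let $S^{\Psi,\Psi'^{\perp}}$ denote its orthogonal complement in $M^{\Psi}$. Then the $K\mathcal{W}$-module $$D^{\Psi,\Psi'} = S^{\Psi,\Psi'}\,/\,\bigl(S^{\Psi,\Psi'}\cap S^{\Psi,\Psi'^{\perp}}\bigr)$$ is zero or irreducible.
   Context: Setting. $V$ is a finite-dimensional real Euclidean space, $\Phi\subset V$ a (reduced, crystallographic) root system with a fixed simple system $\pi$ and corresponding positive system $\Phi^+$. $\mathcal{W}=\mathcal{W}(\Phi)$ is the Weyl group, generated by the reflections $\tau_\alpha$, $\alpha\in\Phi$. A subsystem of $\Phi$ is a subset of $\Phi$ that is itself a root system. For a subsystem $\Psi$ with simple system $J$, $\mathcal{W}(\Psi)=\mathcal{W}(J)$ is the subgroup generated by $\tau_\alpha$, $\alpha\in\Psi$; $\Psi^\perp$ is the largest subsystem of $\Phi$ orthogonal to $\Psi$; $\mathcal{N}(\Psi)=\{w\in\mathcal{W}\mid w\Psi=\Psi\}$; and $D_\Psi=\{w\in\mathcal{W}\mid w(j)\in\Phi^+\text{ for all }j\in J\}$, a set of left coset representatives of $\mathcal{W}(\Psi)$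 in $\mathcal{W}$. $E_\Psi\subseteq D_\Psi$ denotes a set of representatives of the left cosets of $\mathcal{N}(\Psi)$ in $\mathcal{W}$. Useful sub-system. Let $\Psi,\Psi'$ be subsystems of $\Phi$ with simple systems $J,J'\subset\Phi^+$ respectively, such that $\Psi'\subseteq\Phi\setminus\Psi$. The pair $\{J,J'\}$ is a useful sub-system in $\Phi$ if $\mathcal{N}(\Psi)\cap\mathcal{W}(\Psi')=\langle e\rangle$ and $\mathcal{W}(\Psi^\perp)\cap\mathcal{W}(\Psi'^\perp)=\langle e\rangle$. Tabloids. Let $J_1,\dots,J_r$ and $J'_1,\dots,J'_s$ be the (ordered) simple systems of the indecomposable components of $\Psi$ and $\Psi'$, with $J=\bigcup J_i$, $J'=\bigcup J_i'$, and let $\bar J=\{J_1,\dots,J_r;J'_1,\dots,J'_s\}$, an ordered tuple. The $\Delta$-tableaux are the $w\bar J=\overline{wJ}$, $w\in\mathcal{W}$. Two $\Delta$-tableaux $w\bar J$ and $w'\bar J$ are row-equivalent if $w'\bar J=u\,w\bar J$ for some $u\in\mathcal{N}(w\Psi)$. The equivalence class $\{\overline{wJ}\}$ is called a $\Delta^*$-tabloid; the distinct $\Delta^*$-tabloids are $\{\overline{dJ}\}$, $d\in E_\Psi$ (they correspond to the left cosets of $\mathcal{N}(\Psi)$ in $\mathcal{W}$). $\mathcal{W}$ acts on them by $\sigma\{\overline{wJ}\}=\{\overline{\sigma wJ}\}$. $M^\Psi$ is the $K$-vector space with basis the $\Delta^*$-tabloids, made into a $K\mathcal{W}$-module by extending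 this action linearly. Polytabloids. $\kappa_{J'}=\sum_{\sigma\in\mathcal{W}(\Psi')}s(\sigma)\,\sigma$, where $s(\sigma)=(-1)^{l(\sigma)}$ is the sign function ($l$ is length in $\mathcal{W}$), and $e_{J,J'}=\kappa_{J'}\{\bar J\}\in M^\Psi$ is the generalized $\Delta^*$-polytabloid. For $w\in\mathcal{W}$, $e_{wJ,wJ'}=w\,e_{J,J'}$. $S^{\Psi,\Psi'}$ is the $K$-subspace (a $K\mathcal{W}$-submodule) of $M^\Psi$ spanned by all $e_{wJ,wJ'}$, $w\in\mathcal{W}$. Good sub-system. A useful sub-system $\{J,J'\}$ is a good sub-system if, for every $d\in E_\Psi$ with $d\Psi\cap\Psi'=\emptyset$, the $\Delta^*$-tabloid $\{\overline{dJ}\}$ appears with non-zero coefficient in $e_{J,J'}$. Bilinear form. $\langle\cdot,\cdot\rangle$ is the symmetric bilinear form on $M^\Psi$ for which the $\Delta^*$-tabloids form an orthonormal basis, i.e. $\langle\{\bar J_1\},\{\bar J_2\}\rangle=1$ if $\{\bar J_1\}=\{\bar J_2\}$ and $0$ otherwise. $S^{\Psi,\Psi'^{\perp}}=\{m\in M^\Psi\mid\langle m,x\rangle=0\text{ for all }x\in S^{\Psi,\Psi'}\}$. *)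

theory Defs
  imports "HOL-Analysis.Analysis" "HOL-Library.Poly_Mapping"
begin

section \<open>Root systems and Weyl groups\<close>

text \<open>
  A root system is required to span its own linear span only, not the ambient space; this is
  what makes ``a subset that is itself a root system'' a sensible notion of subsystem. The
  empty root system is allowed.
\<close>

definition root_reflection :: "'a::euclidean_space \<Rightarrow> 'a \<Rightarrow> 'a" where
  "root_reflection \<alpha> v = v - (2 * (v \<bullet> \<alpha>) / (\<alpha> \<bullet> \<alpha>)) *\<^sub>R \<alpha>"

definition root_system :: "'a::euclidean_space set \<Rightarrow> bool" where
  "root_system \<Phi> \<longleftrightarrow>
     finite \<Phi> \<and> 0 \<notin> \<Phi> \<and>
     (\<forall>\<alpha>\<in>\<Phi>. root_reflection \<alpha> ` \<Phi> = \<Phi>) \<and>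
     (\<forall>\<alpha>\<in>\<Phi>. \<Phi> \<inter> {c *\<^sub>R \<alpha> | c. True} = {\<alpha>, - \<alpha>}) \<and>
     (\<forall>\<alpha>\<in>\<Phi>. \<forall>\<beta>\<in>\<Phi>. 2 * (\<beta> \<bullet> \<alpha>) / (\<alpha> \<bullet> \<alpha>) \<in> \<int>)"

definition subsystem :: "'a::euclidean_space set \<Rightarrow> 'a set \<Rightarrow> bool" where
  "subsystem \<Psi> \<Phi> \<longleftrightarrow> \<Psi> \<subseteq> \<Phi> \<and> root_system \<Psi>"

definition simple_system :: "'a::euclidean_space set \<Rightarrow> 'a set \<Rightarrow> bool" where
  "simple_system \<Delta> \<Phi> \<longleftrightarrow>
     \<Delta> \<subseteq> \<Phi> \<and> independent \<Delta> \<and>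
     (\<forall>\<alpha>\<in>\<Phi>. \<exists>c. \<alpha> = (\<Sum>\<delta>\<in>\<Delta>. c \<delta> *\<^sub>R \<delta>) \<and>
        ((\<forall>\<delta>\<in>\<Delta>. 0 \<le> c \<delta>) \<or> (\<forall>\<delta>\<in>\<Delta>. c \<delta> \<le> 0)))"

definition positive_system :: "'a::euclidean_space set \<Rightarrow> 'a set \<Rightarrow> 'a set" where
  "positive_system \<Phi> \<pi> =
     {\<alpha> \<in> \<Phi>. \<exists>c. \<alpha> = (\<Sum>\<delta>\<in>\<pi>. c \<delta> *\<^sub>R \<delta>) \<and> (\<forall>\<delta>\<in>\<pi>. (0::real) \<le> c \<delta>)}"

definition orthogonal_sets :: "'a::euclidean_space set \<Rightarrow> 'a set \<Rightarrow> bool" where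
  "orthogonal_sets A B \<longleftrightarrow> (\<forall>\<alpha>\<in>A. \<forall>\<beta>\<in>B. \<alpha> \<bullet> \<beta> = 0)"

definition perp_system :: "'a::euclidean_space set \<Rightarrow> 'a set \<Rightarrow> 'a set" where
  "perp_system \<Phi> \<Psi> = (GREATEST \<Theta>. subsystem \<Theta> \<Phi> \<and> orthogonal_sets \<Theta> \<Psi>)"

inductive_set weyl_group :: "'a::euclidean_space set \<Rightarrow> ('a \<Rightarrow> 'a) set"
  for \<Psi> :: "'a set" where
  weyl_one: "id \<in> weyl_group \<Psi>"
| weyl_reflection: "\<alpha> \<in> \<Psi> \<Longrightarrow> root_reflection \<alpha> \<in> weyl_group \<Psi>"
| weyl_comp: "v \<in> weyl_group \<Psi> \<Longrightarrow> w \<in> weyl_group \<Psi> \<Longrightarrow> v \<circ> w \<in> weyl_group \<Psi>"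
| weyl_inv: "w \<in> weyl_group \<Psi> \<Longrightarrow> inv w \<in> weyl_group \<Psi>"

definition weyl_normalizer :: "'a::euclidean_space set \<Rightarrow> 'a set \<Rightarrow> ('a \<Rightarrow> 'a) set" where
  "weyl_normalizer \<Phi> \<Psi> = {w \<in> weyl_group \<Phi>. w ` \<Psi> = \<Psi>}"

definition weyl_length :: "'a::euclidean_space set \<Rightarrow> ('a \<Rightarrow> 'a) \<Rightarrow> nat" where
  "weyl_length \<pi> w =
     (LEAST n. \<exists>\<alpha>s. length \<alpha>s = n \<and> set \<alpha>s \<subseteq> \<pi> \<and> w = foldr (\<circ>) (map root_reflection \<alpha>s) id)"

definition weyl_sign :: "'a::euclidean_space set \<Rightarrow> ('a \<Rightarrow> 'a) \<Rightarrow> 'k::field" where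
  "weyl_sign \<pi> w = (- 1) ^ weyl_length \<pi> w"

definition coset_set_D :: "'a::euclidean_space set \<Rightarrow> 'a set \<Rightarrow> 'a set \<Rightarrow> ('a \<Rightarrow> 'a) set" where
  "coset_set_D \<Phi> \<pi> J = {w \<in> weyl_group \<Phi>. \<forall>j\<in>J. w j \<in> positive_system \<Phi> \<pi>}"

definition is_coset_set_E ::
    "'a::euclidean_space set \<Rightarrow> 'a set \<Rightarrow> 'a set \<Rightarrow> 'a set \<Rightarrow> ('a \<Rightarrow> 'a) set \<Rightarrow> bool" where
  "is_coset_set_E \<Phi> \<pi> \<Psi> J E \<longleftrightarrow>
     E \<subseteq> coset_set_D \<Phi> \<pi> J \<and>
     (\<forall>w \<in> weyl_group \<Phi>. \<exists>!d. d \<in> E \<and> d \<in> (\<lambda>n. w \<circ> n) ` weyl_normalizer \<Phi> \<Psi>)"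

definition indecomposable_system :: "'a::euclidean_space set \<Rightarrow> bool" where
  "indecomposable_system \<Theta> \<longleftrightarrow>
     root_system \<Theta> \<and> \<Theta> \<noteq> {} \<and>
     \<not> (\<exists>A B. A \<noteq> {} \<and> B \<noteq> {} \<and> \<Theta> = A \<union> B \<and> orthogonal_sets A B)"

definition root_components :: "'a::euclidean_space set \<Rightarrow> 'a set set" where
  "root_components \<Psi> = {\<Theta>. \<Theta> \<subseteq> \<Psi> \<and> indecomposable_system \<Theta> \<and> orthogonal_sets \<Theta> (\<Psi> - \<Theta>)}"

definition ordered_simple_components ::
    "'a::euclidean_space set \<Rightarrow> 'a set \<Rightarrow> 'a set list \<Rightarrow> bool" where
  "ordered_simple_components \<Psi> J Js \<longleftrightarrow>
     (\<exists>\<Psi>s. distinct \<Psi>s \<and> set \<Psi>s = root_components \<Psi> \<and> list_all2 simple_system Js \<Psi>s) \<and>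
     J = \<Union>(set Js)"


section \<open>Modules over a group algebra\<close>

text \<open>
  A module over \<open>KG\<close>, for a group \<open>G\<close> of transformations under composition, is given as a
  \<open>K\<close>-vector space with a \<open>K\<close>-linear action of \<open>G\<close>. The carrier is explicit so that quotients
  can be formed as sets of cosets.
\<close>

record ('k, 'a, 'm) kg_module =
  mcarrier :: "'m set"
  madd :: "'m \<Rightarrow> 'm \<Rightarrow> 'm"
  mzero :: 'm
  msmult :: "'k \<Rightarrow> 'm \<Rightarrow> 'm"
  mact :: "('a \<Rightarrow> 'a) \<Rightarrow> 'm \<Rightarrow> 'm"

definition is_module :: "('a \<Rightarrow> 'a) set \<Rightarrow> ('k::field, 'a, 'm) kg_module \<Rightarrow> bool" where
  "is_module G M \<longleftrightarrow>
     mzero M \<in> mcarrier M \<and>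
     (\<forall>x\<in>mcarrier M. \<forall>y\<in>mcarrier M. madd M x y \<in> mcarrier M) \<and>
     (\<forall>c. \<forall>x\<in>mcarrier M. msmult M c x \<in> mcarrier M) \<and>
     (\<forall>g\<in>G. \<forall>x\<in>mcarrier M. mact M g x \<in> mcarrier M) \<and>
     (\<forall>x\<in>mcarrier M. \<forall>y\<in>mcarrier M. \<forall>z\<in>mcarrier M.
        madd M (madd M x y) z = madd M x (madd M y z)) \<and>
     (\<forall>x\<in>mcarrier M. \<forall>y\<in>mcarrier M. madd M x y = madd M y x) \<and>
     (\<forall>x\<in>mcarrier M. madd M (mzero M) x = x) \<and>
     (\<forall>x\<in>mcarrier M. \<exists>y\<in>mcarrier M. madd M x y = mzero M) \<and>
     (\<forall>c. \<forall>x\<in>mcarrier M. \<forall>y\<in>mcarrier M.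
        msmult M c (madd M x y) = madd M (msmult M c x) (msmult M c y)) \<and>
     (\<forall>c d. \<forall>x\<in>mcarrier M. msmult M (c + d) x = madd M (msmult M c x) (msmult M d x)) \<and>
     (\<forall>c d. \<forall>x\<in>mcarrier M. msmult M (c * d) x = msmult M c (msmult M d x)) \<and>
     (\<forall>x\<in>mcarrier M. msmult M 1 x = x) \<and>
     (\<forall>g\<in>G. \<forall>x\<in>mcarrier M. \<forall>y\<in>mcarrier M.
        mact M g (madd M x y) = madd M (mact M g x) (mact M g y)) \<and>
     (\<forall>g\<in>G. \<forall>c. \<forall>x\<in>mcarrier M. mact M g (msmult M c x) = msmult M c (mact M g x)) \<and>
     (\<forall>g\<in>G. \<forall>h\<in>G. \<forall>x\<in>mcarrier M. mact M (g \<circ> h) x = mact M g (mact M h x)) \<and>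
     (\<forall>x\<in>mcarrier M. mact M id x = x)"

definition is_submodule :: "('a \<Rightarrow> 'a) set \<Rightarrow> 'm set \<Rightarrow> ('k::field, 'a, 'm) kg_module \<Rightarrow> bool" where
  "is_submodule G U M \<longleftrightarrow>
     U \<subseteq> mcarrier M \<and> mzero M \<in> U \<and>
     (\<forall>x\<in>U. \<forall>y\<in>U. madd M x y \<in> U) \<and>
     (\<forall>c. \<forall>x\<in>U. msmult M c x \<in> U) \<and>
     (\<forall>g\<in>G. \<forall>x\<in>U. mact M g x \<in> U)"

definition zero_module :: "('a \<Rightarrow> 'a) set \<Rightarrow> ('k::field, 'a, 'm) kg_module \<Rightarrow> bool" where
  "zero_module G M \<longleftrightarrow> is_module G M \<and> mcarrier M = {mzero M}"

definition irreducible_module :: "('a \<Rightarrow> 'a) set \<Rightarrow> ('k::field, 'a, 'm) kg_module \<Rightarrow> bool" where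
  "irreducible_module G M \<longleftrightarrow>
     is_module G M \<and> mcarrier M \<noteq> {mzero M} \<and>
     (\<forall>U. is_submodule G U M \<longrightarrow> U = {mzero M} \<or> U = mcarrier M)"

definition restrict_module :: "('k, 'a, 'm) kg_module \<Rightarrow> 'm set \<Rightarrow> ('k, 'a, 'm) kg_module" where
  "restrict_module M U = M\<lparr>mcarrier := U\<rparr>"

definition module_coset :: "('k, 'a, 'm) kg_module \<Rightarrow> 'm set \<Rightarrow> 'm \<Rightarrow> 'm set" where
  "module_coset M N x = (\<lambda>n. madd M x n) ` N"

text \<open>
  The operations on cosets are written without choosing representatives. In the scalar
  multiplication \<open>N\<close> is added back since \<open>c \<cdot> (x + N)\<close> is a full coset only for \<open>c \<noteq> 0\<close>.
\<close>

definition quotient_module ::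
    "('k, 'a, 'm) kg_module \<Rightarrow> 'm set \<Rightarrow> ('k, 'a, 'm set) kg_module" where
  "quotient_module M N =
     \<lparr>mcarrier = module_coset M N ` mcarrier M,
      madd = (\<lambda>X Y. {madd M x y | x y. x \<in> X \<and> y \<in> Y}),
      mzero = N,
      msmult = (\<lambda>c X. {madd M (msmult M c x) n | x n. x \<in> X \<and> n \<in> N}),
      mact = (\<lambda>g X. mact M g ` X)\<rparr>"


section \<open>Tabloids\<close>

type_synonym 'a tableau = "'a set list \<times> 'a set list"

type_synonym 'a tabloid = "'a tableau set"

definition tableau_act :: "('a \<Rightarrow> 'a) \<Rightarrow> 'a tableau \<Rightarrow> 'a tableau" where
  "tableau_act w = map_prod (map ((`) w)) (map ((`) w))"

definition tableaux :: "'a::euclidean_space set \<Rightarrow> 'a tableau \<Rightarrow> 'a tableau set" where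
  "tableaux \<Phi> Jbar = {tableau_act w Jbar | w. w \<in> weyl_group \<Phi>}"

definition row_equiv ::
    "'a::euclidean_space set \<Rightarrow> 'a set \<Rightarrow> 'a tableau \<Rightarrow> ('a tableau \<times> 'a tableau) set" where
  "row_equiv \<Phi> \<Psi> Jbar =
     {(tableau_act w Jbar, tableau_act w' Jbar) | w w'.
        w \<in> weyl_group \<Phi> \<and> w' \<in> weyl_group \<Phi> \<and>
        (\<exists>u \<in> weyl_normalizer \<Phi> (w ` \<Psi>).
           tableau_act w' Jbar = tableau_act u (tableau_act w Jbar))}"

definition tabloid :: "'a::euclidean_space set \<Rightarrow> 'a set \<Rightarrow> 'a tableau \<Rightarrow> 'a tableau \<Rightarrow> 'a tabloid" where
  "tabloid \<Phi> \<Psi> Jbar t = row_equiv \<Phi> \<Psi> Jbar `` {t}"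

definition tabloids :: "'a::euclidean_space set \<Rightarrow> 'a set \<Rightarrow> 'a tableau \<Rightarrow> 'a tabloid set" where
  "tabloids \<Phi> \<Psi> Jbar = tableaux \<Phi> Jbar // row_equiv \<Phi> \<Psi> Jbar"

definition tabloid_act :: "('a \<Rightarrow> 'a) \<Rightarrow> 'a tabloid \<Rightarrow> 'a tabloid" where
  "tabloid_act \<sigma> T = tableau_act \<sigma> ` T"


section \<open>The modules attached to a pair of subsystems\<close>

definition fscale :: "'k::field \<Rightarrow> ('t \<Rightarrow>\<^sub>0 'k) \<Rightarrow> ('t \<Rightarrow>\<^sub>0 'k)" where
  "fscale c m = Poly_Mapping.map ((*) c) m"

lemma lookup_fscale [simp]: "Poly_Mapping.lookup (fscale c m) t = c * Poly_Mapping.lookup m t"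
  unfolding fscale_def by transfer (simp add: when_def)

interpretation free_vs: vector_space "fscale :: 'k::field \<Rightarrow> ('t \<Rightarrow>\<^sub>0 'k) \<Rightarrow> ('t \<Rightarrow>\<^sub>0 'k)"
  by unfold_locales (auto intro!: poly_mapping_eqI simp: Poly_Mapping.lookup_add algebra_simps)

definition free_act :: "('a \<Rightarrow> 'a) \<Rightarrow> ('a tabloid \<Rightarrow>\<^sub>0 'k::field) \<Rightarrow> ('a tabloid \<Rightarrow>\<^sub>0 'k)" where
  "free_act \<sigma> m =
     (\<Sum>T\<in>Poly_Mapping.keys m.
        Poly_Mapping.single (tabloid_act \<sigma> T) (Poly_Mapping.lookup m T))"

definition M_module ::
    "'a::euclidean_space set \<Rightarrow> 'a set \<Rightarrow> 'a tableau \<Rightarrow>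
     ('k::field, 'a, 'a tabloid \<Rightarrow>\<^sub>0 'k) kg_module" where
  "M_module \<Phi> \<Psi> Jbar =
     \<lparr>mcarrier = {m. Poly_Mapping.keys m \<subseteq> tabloids \<Phi> \<Psi> Jbar},
      madd = (+), mzero = 0, msmult = fscale, mact = free_act\<rparr>"

definition kappa ::
    "'a::euclidean_space set \<Rightarrow> 'a set \<Rightarrow> ('a tabloid \<Rightarrow>\<^sub>0 'k::field) \<Rightarrow> ('a tabloid \<Rightarrow>\<^sub>0 'k)" where
  "kappa \<pi> \<Psi>' m = (\<Sum>\<sigma>\<in>weyl_group \<Psi>'. fscale (weyl_sign \<pi> \<sigma>) (free_act \<sigma> m))"

definition polytabloid ::
    "'a::euclidean_space set \<Rightarrow> 'a set \<Rightarrow> 'a set \<Rightarrow> 'a set \<Rightarrow> 'a tableau \<Rightarrow>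
     ('a tabloid \<Rightarrow>\<^sub>0 'k::field)" where
  "polytabloid \<Phi> \<pi> \<Psi> \<Psi>' Jbar =
     kappa \<pi> \<Psi>' (Poly_Mapping.single (tabloid \<Phi> \<Psi> Jbar Jbar) 1)"

definition S_space ::
    "'a::euclidean_space set \<Rightarrow> 'a set \<Rightarrow> 'a set \<Rightarrow> 'a set \<Rightarrow> 'a tableau \<Rightarrow>
     ('a tabloid \<Rightarrow>\<^sub>0 'k::field) set" where
  "S_space \<Phi> \<pi> \<Psi> \<Psi>' Jbar =
     free_vs.span {free_act w (polytabloid \<Phi> \<pi> \<Psi> \<Psi>' Jbar) | w. w \<in> weyl_group \<Phi>}"

definition tabloid_form :: "('t \<Rightarrow>\<^sub>0 'k::field) \<Rightarrow> ('t \<Rightarrow>\<^sub>0 'k) \<Rightarrow> 'k" where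
  "tabloid_form m m' =
     (\<Sum>T\<in>Poly_Mapping.keys m. \<Sum>T'\<in>Poly_Mapping.keys m'.
        Poly_Mapping.lookup m T * Poly_Mapping.lookup m' T' * (if T = T' then 1 else 0))"

definition S_perp ::
    "'a::euclidean_space set \<Rightarrow> 'a set \<Rightarrow> 'a set \<Rightarrow> 'a set \<Rightarrow> 'a tableau \<Rightarrow>
     ('a tabloid \<Rightarrow>\<^sub>0 'k::field) set" where
  "S_perp \<Phi> \<pi> \<Psi> \<Psi>' Jbar =
     {m. Poly_Mapping.keys m \<subseteq> tabloids \<Phi> \<Psi> Jbar \<and>
         (\<forall>x\<in>S_space \<Phi> \<pi> \<Psi> \<Psi>' Jbar. tabloid_form m x = 0)}"

definition D_module ::
    "'a::euclidean_space set \<Rightarrow> 'a set \<Rightarrow> 'a set \<Rightarrow> 'a set \<Rightarrow> 'a tableau \<Rightarrow>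
     ('k::field, 'a, ('a tabloid \<Rightarrow>\<^sub>0 'k) set) kg_module" where
  "D_module \<Phi> \<pi> \<Psi> \<Psi>' Jbar =
     quotient_module
       (restrict_module (M_module \<Phi> \<Psi> Jbar) (S_space \<Phi> \<pi> \<Psi> \<Psi>' Jbar))
       (S_space \<Phi> \<pi> \<Psi> \<Psi>' Jbar \<inter> S_perp \<Phi> \<pi> \<Psi> \<Psi>' Jbar)"

definition useful_subsystem ::
    "'a::euclidean_space set \<Rightarrow> 'a set \<Rightarrow> 'a set \<Rightarrow> 'a set \<Rightarrow> 'a set \<Rightarrow> 'a set \<Rightarrow> bool" where
  "useful_subsystem \<Phi> \<pi> \<Psi> J \<Psi>' J' \<longleftrightarrow>
     subsystem \<Psi> \<Phi> \<and> simple_system J \<Psi> \<and> J \<subseteq> positive_system \<Phi> \<pi> \<and>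
     subsystem \<Psi>' \<Phi> \<and> simple_system J' \<Psi>' \<and> J' \<subseteq> positive_system \<Phi> \<pi> \<and>
     \<Psi>' \<subseteq> \<Phi> - \<Psi> \<and>
     weyl_normalizer \<Phi> \<Psi> \<inter> weyl_group \<Psi>' = {id} \<and>
     weyl_group (perp_system \<Phi> \<Psi>) \<inter> weyl_group (perp_system \<Phi> \<Psi>') = {id}"

text \<open>
  Coefficients of the polytabloid are elements of the field, which therefore enters as a type
  argument.
\<close>

definition good_subsystem ::
    "'k::field itself \<Rightarrow> 'a::euclidean_space set \<Rightarrow> 'a set \<Rightarrow> 'a set \<Rightarrow> 'a set \<Rightarrow> 'a set \<Rightarrow> 'a set \<Rightarrow>
     'a tableau \<Rightarrow> ('a \<Rightarrow> 'a) set \<Rightarrow> bool" where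
  "good_subsystem K \<Phi> \<pi> \<Psi> J \<Psi>' J' Jbar E \<longleftrightarrow>
     useful_subsystem \<Phi> \<pi> \<Psi> J \<Psi>' J' \<and>
     (\<forall>d\<in>E. d ` \<Psi> \<inter> \<Psi>' = {} \<longrightarrow>
        Poly_Mapping.lookup (polytabloid \<Phi> \<pi> \<Psi> \<Psi>' Jbar)
          (tabloid \<Phi> \<Psi> Jbar (tableau_act d Jbar)) \<noteq> (0::'k))"


section \<open>Consistency of the definitions\<close>

text \<open>The largest subsystem of \<open>\<Phi>\<close> orthogonal to \<open>\<Psi>\<close> exists.\<close>

lemma root_reflection_involution: "root_reflection \<alpha> (root_reflection \<alpha> v) = v"
proof (cases "\<alpha> = 0")
  case False
  define c where "c = 2 * (v \<bullet> \<alpha>) / (\<alpha> \<bullet> \<alpha>)"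
  have c: "c * (\<alpha> \<bullet> \<alpha>) = 2 * (v \<bullet> \<alpha>)" using False by (simp add: c_def)
  have "2 * ((v - c *\<^sub>R \<alpha>) \<bullet> \<alpha>) / (\<alpha> \<bullet> \<alpha>) = - c"
    by (simp add: inner_diff_left c) (simp add: c_def)
  then show ?thesis by (simp add: root_reflection_def flip: c_def)
qed (simp add: root_reflection_def)

lemma perp_system_eq:
  assumes "root_system \<Phi>"
  shows "perp_system \<Phi> \<Psi> = {\<alpha> \<in> \<Phi>. \<forall>\<beta>\<in>\<Psi>. \<alpha> \<bullet> \<beta> = 0}" (is "_ = ?P")
  unfolding perp_system_def
proof (rule Greatest_equality)
  have sub: "root_reflection \<alpha> \<beta> \<in> ?P" if "\<alpha> \<in> ?P" "\<beta> \<in> ?P" for \<alpha> \<beta>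
  proof -
    have "root_reflection \<alpha> \<beta> \<in> \<Phi>"
      using assms that unfolding root_system_def by blast
    then show ?thesis using that by (simp add: root_reflection_def inner_diff_left)
  qed
  have refl: "root_reflection \<alpha> ` ?P = ?P" if "\<alpha> \<in> ?P" for \<alpha>
  proof
    show "root_reflection \<alpha> ` ?P \<subseteq> ?P" using sub[OF that] by blast
    show "?P \<subseteq> root_reflection \<alpha> ` ?P"
    proof
      fix \<beta> assume "\<beta> \<in> ?P"
      then show "\<beta> \<in> root_reflection \<alpha> ` ?P"
        by (intro image_eqI[of _ _ "root_reflection \<alpha> \<beta>"] sub[OF that])
           (simp add: root_reflection_involution)
    qed
  qed
  have red: "?P \<inter> {c *\<^sub>R \<alpha> | c. True} = {\<alpha>, - \<alpha>}" if "\<alpha> \<in> ?P" for \<alpha>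
  proof -
    have eq: "\<Phi> \<inter> {c *\<^sub>R \<alpha> | c. True} = {\<alpha>, - \<alpha>}"
      using assms that by (simp add: root_system_def)
    then have "- \<alpha> \<in> \<Phi>" by blast
    then have "{\<alpha>, - \<alpha>} \<subseteq> ?P" using that by simp
    moreover have "?P \<inter> {c *\<^sub>R \<alpha> | c. True} = ?P \<inter> {\<alpha>, - \<alpha>}"
      unfolding eq[symmetric] by (simp add: Int_assoc[symmetric] inf.absorb1 Collect_restrict)
    ultimately show ?thesis by (simp add: inf.absorb2)
  qed
  show "subsystem ?P \<Phi> \<and> orthogonal_sets ?P \<Psi>"
    unfolding subsystem_def orthogonal_sets_def root_system_def
  proof (intro conjI ballI)
    show "finite ?P" "0 \<notin> ?P"
      using assms by (auto simp: root_system_def)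
    show "root_reflection \<alpha> ` ?P = ?P" "?P \<inter> {c *\<^sub>R \<alpha> | c. True} = {\<alpha>, - \<alpha>}"
      if "\<alpha> \<in> ?P" for \<alpha>
      using refl[OF that] red[OF that] .
    show "2 * (\<beta> \<bullet> \<alpha>) / (\<alpha> \<bullet> \<alpha>) \<in> \<int>" if "\<alpha> \<in> ?P" "\<beta> \<in> ?P" for \<alpha> \<beta>
      using assms that unfolding root_system_def by blast
  qed auto
qed (auto simp: subsystem_def orthogonal_sets_def)

text \<open>The action on tabloids is \<open>\<sigma>{w Jbar} = {\<sigma>w Jbar}\<close>.\<close>

lemma weyl_group_bij: "w \<in> weyl_group \<Psi> \<Longrightarrow> bij w"
proof (induction rule: weyl_group.induct)
  case (weyl_reflection \<alpha>)
  show ?case by (rule o_bij[of "root_reflection \<alpha>"]) (auto simp: root_reflection_involution)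
qed (blast intro: bij_id bij_comp bij_imp_bij_inv)+

lemma tableau_act_comp: "tableau_act v (tableau_act w t) = tableau_act (v \<circ> w) t"
  by (cases t) (simp add: tableau_act_def image_comp comp_def)

lemma tabloid_act_tabloid_subset:
  assumes "\<sigma> \<in> weyl_group \<Phi>" "w \<in> weyl_group \<Phi>"
  shows "tabloid_act \<sigma> (tabloid \<Phi> \<Psi> Jbar (tableau_act w Jbar))
       \<subseteq> tabloid \<Phi> \<Psi> Jbar (tableau_act (\<sigma> \<circ> w) Jbar)"
proof
  fix t assume "t \<in> tabloid_act \<sigma> (tabloid \<Phi> \<Psi> Jbar (tableau_act w Jbar))"
  then obtain w1 w' u where *: "w1 \<in> weyl_group \<Phi>" "w' \<in> weyl_group \<Phi>"
      "u \<in> weyl_normalizer \<Phi> (w1 ` \<Psi>)" "tableau_act w Jbar = tableau_act w1 Jbar"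
      "tableau_act w' Jbar = tableau_act u (tableau_act w1 Jbar)"
      "t = tableau_act \<sigma> (tableau_act w' Jbar)"
    unfolding tabloid_act_def tabloid_def row_equiv_def by auto
  have \<sigma>: "bij \<sigma>" by (rule weyl_group_bij[OF assms(1)])
  then have inv\<sigma>: "inv \<sigma> \<circ> \<sigma> = id" by (simp add: bij_is_inj)
  define v where "v = \<sigma> \<circ> u \<circ> inv \<sigma>"
  have v\<sigma>: "v \<circ> (\<sigma> \<circ> w1) = \<sigma> \<circ> (u \<circ> w1)"
    using inv\<sigma> by (simp add: v_def fun_eq_iff)
  have u: "u \<in> weyl_group \<Phi>" "u ` w1 ` \<Psi> = w1 ` \<Psi>"
    using *(3) by (auto simp: weyl_normalizer_def)
  have "v ` (\<sigma> \<circ> w1) ` \<Psi> = \<sigma> ` u ` w1 ` \<Psi>"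
    using arg_cong[OF v\<sigma>, of "\<lambda>f. f ` \<Psi>"] by (simp add: image_comp comp_assoc)
  also have "\<dots> = (\<sigma> \<circ> w1) ` \<Psi>" by (simp only: u(2)) (simp only: image_comp)
  finally have "v ` (\<sigma> \<circ> w1) ` \<Psi> = (\<sigma> \<circ> w1) ` \<Psi>" .
  moreover have "v \<in> weyl_group \<Phi>"
    unfolding v_def by (intro weyl_group.weyl_comp weyl_group.weyl_inv u assms)
  ultimately have "v \<in> weyl_normalizer \<Phi> ((\<sigma> \<circ> w1) ` \<Psi>)"
    unfolding weyl_normalizer_def by blast
  moreover have "t = tableau_act (\<sigma> \<circ> w') Jbar" "\<sigma> \<circ> w' \<in> weyl_group \<Phi>"
      "\<sigma> \<circ> w1 \<in> weyl_group \<Phi>"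
    using *(1,2,6) assms(1) by (simp_all only: tableau_act_comp weyl_group.weyl_comp)
  moreover have "tableau_act (\<sigma> \<circ> w) Jbar = tableau_act (\<sigma> \<circ> w1) Jbar"
    using *(4) by (simp flip: tableau_act_comp)
  moreover have "tableau_act (\<sigma> \<circ> w') Jbar = tableau_act v (tableau_act (\<sigma> \<circ> w1) Jbar)"
    unfolding tableau_act_comp v\<sigma> using *(5) by (simp flip: tableau_act_comp)
  ultimately show "t \<in> tabloid \<Phi> \<Psi> Jbar (tableau_act (\<sigma> \<circ> w) Jbar)"
    unfolding tabloid_def row_equiv_def by blast
qed

lemma tabloid_act_tabloid:
  assumes "\<sigma> \<in> weyl_group \<Phi>" "w \<in> weyl_group \<Phi>"
  shows "tabloid_act \<sigma> (tabloid \<Phi> \<Psi> Jbar (tableau_act w Jbar))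
       = tabloid \<Phi> \<Psi> Jbar (tableau_act (\<sigma> \<circ> w) Jbar)"
proof
  have \<sigma>: "bij \<sigma>" by (rule weyl_group_bij[OF assms(1)])
  have "tabloid_act (inv \<sigma>) (tabloid \<Phi> \<Psi> Jbar (tableau_act (\<sigma> \<circ> w) Jbar))
      \<subseteq> tabloid \<Phi> \<Psi> Jbar (tableau_act (inv \<sigma> \<circ> (\<sigma> \<circ> w)) Jbar)"
    by (intro tabloid_act_tabloid_subset weyl_group.weyl_inv weyl_group.weyl_comp assms)
  also have "inv \<sigma> \<circ> (\<sigma> \<circ> w) = w" using \<sigma> by (simp add: fun_eq_iff bij_is_inj)
  finally have "tabloid_act \<sigma> (tabloid_act (inv \<sigma>) (tabloid \<Phi> \<Psi> Jbar (tableau_act (\<sigma> \<circ> w) Jbar)))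
      \<subseteq> tabloid_act \<sigma> (tabloid \<Phi> \<Psi> Jbar (tableau_act w Jbar))"
    unfolding tabloid_act_def by (rule image_mono)
  moreover have "tabloid_act \<sigma> (tabloid_act (inv \<sigma>) X) = X" for X
  proof -
    have "\<sigma> \<circ> inv \<sigma> = id" using \<sigma> bij_is_surj surj_iff by blast
    moreover have "tableau_act id t = t" for t :: "'a tableau"
      by (cases t) (simp add: tableau_act_def)
    ultimately show ?thesis
      by (simp add: tabloid_act_def image_image tableau_act_comp)
  qed
  ultimately show "tabloid \<Phi> \<Psi> Jbar (tableau_act (\<sigma> \<circ> w) Jbar)
      \<subseteq> tabloid_act \<sigma> (tabloid \<Phi> \<Psi> Jbar (tableau_act w Jbar))" by simp
qed (rule tabloid_act_tabloid_subset[OF assms])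

end

theory Submission
  imports Defs
begin

text \<open>
  The argument is James' submodule theorem. If \<open>d \<Psi>\<close> meets \<open>\<Psi>'\<close> in a root \<open>\<alpha>\<close>, then
  \<open>\<tau>\<^sub>\<alpha>\<close> fixes the tabloid of \<open>d\<close> and has sign \<open>-1\<close>, so \<open>\<kappa>\<close> kills that tabloid; otherwise goodness
  makes the tabloid a translate of the base tabloid by an element of \<open>W(\<Psi>')\<close>, and \<open>\<kappa>\<close> sends it to
  \<open>\<plusminus>e\<close>. Hence \<open>\<kappa>\<close> maps the whole of \<open>M\<close> into the line spanned by the polytabloid \<open>e\<close>, and since
  \<open>\<kappa>\<close> is self-adjoint every submodule of \<open>M\<close> contains \<open>S\<close> or is orthogonal to it. That the sign
  is multiplicative with value \<open>-1\<close> on all reflections rests on the generation of \<open>W\<close> by simple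
  reflections and on counting inversions.
\<close>

section \<open>The sign character\<close>

definition reflection_word :: "'a::euclidean_space list \<Rightarrow> 'a \<Rightarrow> 'a" where
  "reflection_word \<alpha>s = foldr (\<circ>) (map root_reflection \<alpha>s) id"

lemma reflection_word_Nil [simp]: "reflection_word [] = id"
  and reflection_word_Cons [simp]:
    "reflection_word (\<alpha> # \<alpha>s) = root_reflection \<alpha> \<circ> reflection_word \<alpha>s"
  by (simp_all add: reflection_word_def)

lemma reflection_word_append:
  "reflection_word (\<alpha>s @ \<beta>s) = reflection_word \<alpha>s \<circ> reflection_word \<beta>s"
  by (induction \<alpha>s) (simp_all add: comp_assoc)

text \<open>Reflections are involutions, so the two words cancel letter by letter from the middle
  outwards.\<close>

lemma reflection_word_rev: "reflection_word (rev \<alpha>s) \<circ> reflection_word \<alpha>s = id"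
proof (induction \<alpha>s)
  case (Cons \<alpha> \<alpha>s)
  then show ?case
    by (simp add: reflection_word_append fun_eq_iff root_reflection_involution)
qed simp

lemma inv_reflection_word: "inv (reflection_word \<alpha>s) = reflection_word (rev \<alpha>s)"
  using reflection_word_rev[of \<alpha>s] reflection_word_rev[of "rev \<alpha>s"] by (intro inv_unique_comp) auto

lemma orthogonal_transformation_root_reflection: "orthogonal_transformation (root_reflection \<alpha>)"
  unfolding orthogonal_transformation_def
proof (intro conjI allI)
  show "linear (root_reflection \<alpha>)"
    by (rule linearI)
       (simp_all add: root_reflection_def inner_add_left algebra_simps add_divide_distrib)
  show "root_reflection \<alpha> v \<bullet> root_reflection \<alpha> w = v \<bullet> w" for v w
    \<comment> \<open>For \<alpha> = 0 division by zero gives coefficient 0 and the map is the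
      identity.\<close>
    by (cases "\<alpha> = 0")
       (simp_all add: root_reflection_def inner_diff_left inner_diff_right inner_commute field_simps)
qed

lemma orthogonal_transformation_weyl_group:
  "w \<in> weyl_group \<Psi> \<Longrightarrow> orthogonal_transformation w"
proof (induction rule: weyl_group.induct)
  case weyl_one
  then show ?case by (simp add: orthogonal_transformation_id id_def)
next
  case (weyl_comp v w)
  then show ?case by (intro orthogonal_transformation_compose)
next
  case (weyl_inv w)
  then show ?case
    using orthogonal_transformation_inv by blast
qed (simp add: orthogonal_transformation_root_reflection)

text \<open>The coefficient in a reflection is made of inner products, which \<open>w\<close>
  preserves; linearity does the rest.\<close>

lemma root_reflection_conj:
  assumes "orthogonal_transformation w"
  shows "w \<circ> root_reflection \<alpha> = root_reflection (w \<alpha>) \<circ> w"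
  using assms unfolding orthogonal_transformation_def
  by (auto simp: fun_eq_iff root_reflection_def linear_diff linear_scale)

text \<open>Stated for every orthogonal map: the later application is to a map that is not assumed
  to be a Weyl group element of the root system in question.\<close>

lemma reflection_word_conj:
  assumes "orthogonal_transformation w"
  shows "w (reflection_word \<alpha>s v) = reflection_word (map w \<alpha>s) (w v)"
proof (induction \<alpha>s)
  case (Cons \<alpha> \<alpha>s)
  then show ?case
    using root_reflection_conj[OF assms, of \<alpha>] by (simp add: fun_eq_iff)
qed simp

lemma root_system_uminus: "root_system \<Phi> \<Longrightarrow> \<alpha> \<in> \<Phi> \<Longrightarrow> - \<alpha> \<in> \<Phi>"
  unfolding root_system_def by blast

lemma root_system_root_reflection:
  "root_system \<Phi> \<Longrightarrow> \<alpha> \<in> \<Phi> \<Longrightarrow> \<beta> \<in> \<Phi> \<Longrightarrow> root_reflection \<alpha> \<beta> \<in> \<Phi>"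
  unfolding root_system_def by blast

lemma root_system_reflection_word:
  "root_system \<Phi> \<Longrightarrow> set \<alpha>s \<subseteq> \<Phi> \<Longrightarrow> \<beta> \<in> \<Phi> \<Longrightarrow> reflection_word \<alpha>s \<beta> \<in> \<Phi>"
  by (induction \<alpha>s) (auto simp: root_system_root_reflection)

lemma root_system_multiple:
  "root_system \<Phi> \<Longrightarrow> \<alpha> \<in> \<Phi> \<Longrightarrow> c *\<^sub>R \<alpha> \<in> \<Phi> \<Longrightarrow> c *\<^sub>R \<alpha> = \<alpha> \<or> c *\<^sub>R \<alpha> = - \<alpha>"
  unfolding root_system_def by blast

lemma weyl_group_image:
  assumes "root_system \<Phi>" "w \<in> weyl_group \<Phi>"
  shows "w ` \<Phi> = \<Phi>"
  using assms(2)
proof (induction rule: weyl_group.induct)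
  case (weyl_inv w)
  then show ?case
    by (metis weyl_group_bij bij_def image_inv_f_f)
next
  case (weyl_comp v w)
  then show ?case by (metis image_comp)
qed (use assms(1) in \<open>auto simp: root_system_def\<close>)

lemma weyl_group_mono:
  assumes "\<Psi> \<subseteq> \<Phi>" shows "weyl_group \<Psi> \<subseteq> weyl_group \<Phi>"
proof
  fix w assume "w \<in> weyl_group \<Psi>"
  then show "w \<in> weyl_group \<Phi>"
    by induction (use assms in \<open>blast intro: weyl_group.intros\<close>)+
qed

text \<open>Instantiated twice: for \<Phi> with \<pi>, and for the subsystem \<Psi> with J, where
  the simple roots must determine the whole subsystem.\<close>

locale based_root_system =
  fixes \<Phi> \<pi> :: "'a::euclidean_space set"
  assumes root_system: "root_system \<Phi>" and simple_system: "simple_system \<pi> \<Phi>"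
begin

abbreviation "P \<equiv> positive_system \<Phi> \<pi>"

section \<open>Positive roots and simple reflections\<close>

lemma simple_subset: "\<pi> \<subseteq> \<Phi>" and independent_simple: "independent \<pi>"
  using simple_system by (auto simp: simple_system_def)

lemma finite_simple: "finite \<pi>"
  using independent_simple by (rule finiteI_independent)

lemma finite_positive: "finite P"
  using root_system by (auto simp: positive_system_def root_system_def)

lemma coeff_unique:
  assumes "(\<Sum>\<delta>\<in>\<pi>. c \<delta> *\<^sub>R \<delta>) = (\<Sum>\<delta>\<in>\<pi>. d \<delta> *\<^sub>R \<delta>)" "\<delta> \<in> \<pi>"
  shows "c \<delta> = d \<delta>"
proof -
  have "(\<Sum>\<delta>\<in>\<pi>. (c \<delta> - d \<delta>) *\<^sub>R \<delta>) = 0"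
    using assms(1) by (simp add: scaleR_left_diff_distrib sum_subtractf)
  then have "c \<delta> - d \<delta> = 0"
    by (rule independentD[OF independent_simple finite_simple order_refl]) (rule assms(2))
  then show ?thesis by simp
qed

lemma simple_positive: "\<delta> \<in> \<pi> \<Longrightarrow> \<delta> \<in> P"
proof -
  assume \<delta>: "\<delta> \<in> \<pi>"
  have "\<delta> = (\<Sum>\<gamma>\<in>\<pi>. (if \<gamma> = \<delta> then 1 else 0) *\<^sub>R \<gamma>)"
    using \<delta> finite_simple by (simp add: if_distrib[of "\<lambda>x. x *\<^sub>R _"] cong: if_cong)
  then show ?thesis
    using \<delta> simple_subset unfolding positive_system_def
    by (intro CollectI conjI exI[of _ "\<lambda>\<gamma>. if \<gamma> = \<delta> then 1 else 0"]) auto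
qed

lemma positive_or_negative:
  assumes "\<beta> \<in> \<Phi>" shows "\<beta> \<in> P \<or> - \<beta> \<in> P"
proof -
  obtain c where c: "\<beta> = (\<Sum>\<delta>\<in>\<pi>. c \<delta> *\<^sub>R \<delta>)"
      "(\<forall>\<delta>\<in>\<pi>. 0 \<le> c \<delta>) \<or> (\<forall>\<delta>\<in>\<pi>. c \<delta> \<le> 0)"
    using simple_system assms by (auto simp: simple_system_def)
  from c(2) show ?thesis
  proof
    assume "\<forall>\<delta>\<in>\<pi>. 0 \<le> c \<delta>"
    then show ?thesis using c(1) assms by (auto simp: positive_system_def)
  next
    assume *: "\<forall>\<delta>\<in>\<pi>. c \<delta> \<le> 0"
    have "- \<beta> = (\<Sum>\<delta>\<in>\<pi>. (- c \<delta>) *\<^sub>R \<delta>)" by (simp add: c(1) sum_negf)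
    then have "- \<beta> \<in> P"
      using * root_system_uminus[OF root_system assms] unfolding positive_system_def
      by (intro CollectI conjI exI[of _ "\<lambda>\<delta>. - c \<delta>"]) auto
    then show ?thesis ..
  qed
qed

text \<open>By uniqueness of coefficients all of them would be both nonnegative and nonpositive,
  hence zero, and 0 is not a root.\<close>

lemma positive_not_negative:
  assumes "\<beta> \<in> P" shows "- \<beta> \<notin> P"
proof
  assume "- \<beta> \<in> P"
  then obtain d where d: "- \<beta> = (\<Sum>\<delta>\<in>\<pi>. d \<delta> *\<^sub>R \<delta>)" "\<forall>\<delta>\<in>\<pi>. 0 \<le> d \<delta>"
    by (auto simp: positive_system_def)
  obtain c where c: "\<beta> = (\<Sum>\<delta>\<in>\<pi>. c \<delta> *\<^sub>R \<delta>)" "\<forall>\<delta>\<in>\<pi>. 0 \<le> c \<delta>"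
    using assms by (auto simp: positive_system_def)
  have "(\<Sum>\<delta>\<in>\<pi>. c \<delta> *\<^sub>R \<delta>) = (\<Sum>\<delta>\<in>\<pi>. (- d \<delta>) *\<^sub>R \<delta>)"
    using d(1) c(1) by (simp add: sum_negf) (metis minus_minus)
  then have "c \<delta> = 0" if "\<delta> \<in> \<pi>" for \<delta>
    using coeff_unique[of c "\<lambda>\<delta>. - d \<delta>", OF _ that] c(2) d(2) that by force
  then have "\<beta> = 0" using c(1) by simp
  then show False using assms root_system by (auto simp: positive_system_def root_system_def)
qed

text \<open>The reflection changes only the coefficient at \<alpha>. Some other coefficient of
  \<beta> is positive and survives, and the coefficients of a root all have one sign.\<close>

lemma simple_reflection_positive:
  assumes \<alpha>: "\<alpha> \<in> \<pi>" and \<beta>: "\<beta> \<in> P" "\<beta> \<noteq> \<alpha>"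
  shows "root_reflection \<alpha> \<beta> \<in> P"
proof -
  obtain c where c: "\<beta> = (\<Sum>\<delta>\<in>\<pi>. c \<delta> *\<^sub>R \<delta>)" "\<forall>\<delta>\<in>\<pi>. 0 \<le> c \<delta>" and "\<beta> \<in> \<Phi>"
    using \<beta> by (auto simp: positive_system_def)
  \<comment> \<open>Otherwise \<beta> would be a multiple of \<alpha>; reducedness leaves only
    \<alpha> and its negative, and both are excluded.\<close>
  have "\<exists>\<delta>\<in>\<pi>. \<delta> \<noteq> \<alpha> \<and> c \<delta> \<noteq> 0"
  proof (rule ccontr)
    assume "\<not> ?thesis"
    then have "\<beta> = (\<Sum>\<delta>\<in>\<pi>. (if \<delta> = \<alpha> then c \<alpha> *\<^sub>R \<alpha> else 0))"
      unfolding c(1) by (intro sum.cong) auto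
    then have "\<beta> = c \<alpha> *\<^sub>R \<alpha>" using \<alpha> finite_simple by simp
    then have "\<beta> = - \<alpha>"
      using root_system_multiple[OF root_system, of \<alpha> "c \<alpha>"] \<alpha> \<beta>(2) simple_subset \<open>\<beta> \<in> \<Phi>\<close> by auto
    then show False using positive_not_negative[OF simple_positive[OF \<alpha>]] \<beta>(1) by simp
  qed
  then obtain \<delta> where \<delta>: "\<delta> \<in> \<pi>" "\<delta> \<noteq> \<alpha>" "0 < c \<delta>" using c(2) by force
  define k where "k = 2 * (\<beta> \<bullet> \<alpha>) / (\<alpha> \<bullet> \<alpha>)"
  define c' where "c' = (\<lambda>\<gamma>. c \<gamma> - (if \<gamma> = \<alpha> then k else 0))"
  have "(\<Sum>\<gamma>\<in>\<pi>. (if \<gamma> = \<alpha> then k else 0) *\<^sub>R \<gamma>) = k *\<^sub>R \<alpha>"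
    using \<alpha> finite_simple by (simp add: if_distrib[of "\<lambda>x. x *\<^sub>R _"] cong: if_cong)
  then have c': "root_reflection \<alpha> \<beta> = (\<Sum>\<gamma>\<in>\<pi>. c' \<gamma> *\<^sub>R \<gamma>)"
    unfolding root_reflection_def k_def[symmetric] c'_def
    by (simp add: scaleR_left_diff_distrib sum_subtractf flip: c(1))
  have in_\<Phi>: "root_reflection \<alpha> \<beta> \<in> \<Phi>"
    using root_system_root_reflection[OF root_system] \<alpha> simple_subset \<open>\<beta> \<in> \<Phi>\<close> by blast
  show ?thesis
  proof (rule ccontr)
    assume "root_reflection \<alpha> \<beta> \<notin> P"
    then have "- root_reflection \<alpha> \<beta> \<in> P" using positive_or_negative[OF in_\<Phi>] by blast
    then obtain d where d: "- root_reflection \<alpha> \<beta> = (\<Sum>\<delta>\<in>\<pi>. d \<delta> *\<^sub>R \<delta>)" "\<forall>\<delta>\<in>\<pi>. 0 \<le> d \<delta>"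
      by (auto simp: positive_system_def)
    have "(\<Sum>\<delta>\<in>\<pi>. c' \<delta> *\<^sub>R \<delta>) = (\<Sum>\<delta>\<in>\<pi>. (- d \<delta>) *\<^sub>R \<delta>)"
      using d(1) c' by (simp add: sum_negf) (metis minus_minus)
    then have "c' \<delta> = - d \<delta>" using coeff_unique[of c' "\<lambda>\<delta>. - d \<delta>"] \<delta>(1) by blast
    then show False using \<delta> d(2) by (auto simp: c'_def)
  qed
qed

section \<open>Heights of roots and generation by simple reflections\<close>

text \<open>A positive root that is not simple can be lowered in height by a simple reflection while
  staying positive. Heights are only known to be real, so the induction counts the positive roots of
  smaller height.\<close>

lemma positive_root_conjugate_simple:
  assumes "\<beta> \<in> P"
  shows "\<exists>\<alpha>s \<alpha>. set \<alpha>s \<subseteq> \<pi> \<and> \<alpha> \<in> \<pi> \<and> \<beta> = reflection_word \<alpha>s \<alpha>"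
proof -
  \<comment> \<open>The height functional: the linear map with value 1 on every simple root.\<close>
  obtain f where f: "linear f" "\<And>\<delta>. \<delta> \<in> \<pi> \<Longrightarrow> f \<delta> = (1::real)"
    using linear_independent_extend[OF independent_simple, of "\<lambda>_. 1"] by auto
  show ?thesis
    using assms
  proof (induction "card {\<gamma> \<in> P. f \<gamma> < f \<beta>}" arbitrary: \<beta> rule: less_induct)
    case less
    show ?case
    proof (cases "\<beta> \<in> \<pi>")
      case True
      then show ?thesis by (intro exI[of _ "[]"] exI[of _ \<beta>]) simp
    next
      case False
      obtain c where c: "\<beta> = (\<Sum>\<delta>\<in>\<pi>. c \<delta> *\<^sub>R \<delta>)" "\<forall>\<delta>\<in>\<pi>. 0 \<le> c \<delta>" and "\<beta> \<in> \<Phi>"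
        using less.prems by (auto simp: positive_system_def)
      \<comment> \<open>If every such product were nonpositive, expanding one factor of \<beta>
        \<bullet> \<beta> with nonnegative coefficients would force \<beta> = 0.\<close>
      have "\<exists>\<alpha>\<in>\<pi>. 0 < \<beta> \<bullet> \<alpha>"
      proof (rule ccontr)
        assume "\<not> ?thesis"
        then have "(\<Sum>\<delta>\<in>\<pi>. c \<delta> * (\<beta> \<bullet> \<delta>)) \<le> 0"
          using c(2) by (intro sum_nonpos mult_nonneg_nonpos) force+
        moreover have "\<beta> \<bullet> \<beta> = (\<Sum>\<delta>\<in>\<pi>. c \<delta> * (\<beta> \<bullet> \<delta>))"
          by (subst (2) c(1)) (simp add: inner_sum_right)
        ultimately have "\<beta> = 0" by (metis inner_ge_zero inner_eq_zero_iff order_antisym)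
        then show False using \<open>\<beta> \<in> \<Phi>\<close> root_system by (simp add: root_system_def)
      qed
      then obtain \<alpha> where \<alpha>: "\<alpha> \<in> \<pi>" "0 < \<beta> \<bullet> \<alpha>" by blast
      then have \<beta>': "root_reflection \<alpha> \<beta> \<in> P"
        using simple_reflection_positive less.prems False by blast
      have "\<alpha> \<noteq> 0" using \<alpha>(2) by auto
      then have lt: "f (root_reflection \<alpha> \<beta>) < f \<beta>"
        using f \<alpha> by (simp add: root_reflection_def linear_diff linear_scale)
      \<comment> \<open>The reflected root lies in the larger set but not in the smaller one, so the
        inclusion is strict.\<close>
      have "card {\<gamma> \<in> P. f \<gamma> < f (root_reflection \<alpha> \<beta>)} < card {\<gamma> \<in> P. f \<gamma> < f \<beta>}"
        using finite_positive lt \<beta>' by (intro psubset_card_mono) auto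
      from less.hyps[OF this \<beta>'] obtain \<alpha>s \<gamma> where
        "set \<alpha>s \<subseteq> \<pi>" "\<gamma> \<in> \<pi>" "root_reflection \<alpha> \<beta> = reflection_word \<alpha>s \<gamma>" by blast
      moreover from this have "\<beta> = reflection_word (\<alpha> # \<alpha>s) \<gamma>"
        by simp (metis root_reflection_involution)
      ultimately show ?thesis using \<alpha>(1) by (intro exI[of _ "\<alpha> # \<alpha>s"]) auto
    qed
  qed
qed

text \<open>Every root is, up to sign, a word in simple reflections applied to a simple root.
  Conjugating that word by \<open>x\<close> again gives a word in simple reflections applied to a
  simple root. Finiteness and injectivity turn the inclusion into equality.\<close>

lemma orthogonal_transformation_preserves_root_system:
  assumes x: "orthogonal_transformation x" "x ` \<pi> = \<pi>"
  shows "x ` \<Phi> = \<Phi>"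
proof (rule endo_inj_surj)
  show "finite \<Phi>" using root_system by (simp add: root_system_def)
  show "inj_on x \<Phi>"
    using orthogonal_transformation_inj[OF x(1)] by (rule inj_on_subset) simp
  have pos: "x \<beta> \<in> \<Phi>" if "\<beta> \<in> P" for \<beta>
  proof -
    obtain \<alpha>s \<alpha> where "set \<alpha>s \<subseteq> \<pi>" "\<alpha> \<in> \<pi>" "\<beta> = reflection_word \<alpha>s \<alpha>"
      using positive_root_conjugate_simple[OF \<open>\<beta> \<in> P\<close>] by blast
    moreover from this have "set (map x \<alpha>s) \<subseteq> \<Phi>" "x \<alpha> \<in> \<Phi>" using x(2) simple_subset by auto
    ultimately show ?thesis
      by (simp only: reflection_word_conj[OF x(1)] root_system_reflection_word[OF root_system])
  qed
  show "x ` \<Phi> \<subseteq> \<Phi>"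
  proof (rule image_subsetI)
    fix \<beta> assume "\<beta> \<in> \<Phi>"
    then consider "\<beta> \<in> P" | "- \<beta> \<in> P" using positive_or_negative by blast
    then show "x \<beta> \<in> \<Phi>"
    proof cases
      case 2
      have "x \<beta> = - x (- \<beta>)"
        using x(1) by (simp add: orthogonal_transformation_def linear_neg)
      then show ?thesis using root_system_uminus[OF root_system pos[OF 2]] by simp
    qed (rule pos)
  qed
qed

text \<open>If \<gamma> = u \<alpha> with \<alpha> simple, the reflection in \<gamma> is the
  conjugate by u of the one in \<alpha>: a palindrome with one middle letter. Its odd length is what
  later gives every reflection sign -1.\<close>

lemma root_reflection_word:
  assumes "\<beta> \<in> \<Phi>"
  shows "\<exists>\<alpha>s. set \<alpha>s \<subseteq> \<pi> \<and> odd (length \<alpha>s) \<and> root_reflection \<beta> = reflection_word \<alpha>s"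
proof -
  have pos: ?thesis if "\<gamma> \<in> P" "root_reflection \<gamma> = root_reflection \<beta>" for \<gamma>
  proof -
    obtain \<alpha>s \<alpha> where *: "set \<alpha>s \<subseteq> \<pi>" "\<alpha> \<in> \<pi>" "\<gamma> = reflection_word \<alpha>s \<alpha>"
      using positive_root_conjugate_simple[OF \<open>\<gamma> \<in> P\<close>] by blast
    have orth: "orthogonal_transformation (reflection_word \<alpha>s)"
    proof (induction \<alpha>s)
      case Nil
      then show ?case by (simp add: orthogonal_transformation_id id_def)
    next
      case (Cons \<alpha> \<alpha>s)
      then show ?case
        unfolding reflection_word_Cons
        by (intro orthogonal_transformation_compose orthogonal_transformation_root_reflection)
    qed
    have "root_reflection \<gamma> = root_reflection \<gamma> \<circ> (reflection_word \<alpha>s \<circ> reflection_word (rev \<alpha>s))"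
      using reflection_word_rev[of "rev \<alpha>s"] by simp
    also have "\<dots> = reflection_word \<alpha>s \<circ> root_reflection \<alpha> \<circ> reflection_word (rev \<alpha>s)"
      unfolding root_reflection_conj[OF orth] *(3) by (simp add: comp_assoc)
    also have "\<dots> = reflection_word (\<alpha>s @ [\<alpha>] @ rev \<alpha>s)"
      by (simp add: reflection_word_append comp_assoc)
    finally show ?thesis
      using * that by (intro exI[of _ "\<alpha>s @ [\<alpha>] @ rev \<alpha>s"]) auto
  qed
  \<comment> \<open>This reduces a negative root to its positive opposite.\<close>
  have "root_reflection (- \<beta>) = root_reflection \<beta>"
    by (simp add: root_reflection_def fun_eq_iff)
  then show ?thesis using pos positive_or_negative[OF assms] by blast
qed

lemma weyl_group_word:
  assumes "w \<in> weyl_group \<Phi>"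
  shows "\<exists>\<alpha>s. set \<alpha>s \<subseteq> \<pi> \<and> w = reflection_word \<alpha>s"
  using assms
proof (induction rule: weyl_group.induct)
  case weyl_one
  then show ?case by (intro exI[of _ "[]"]) simp
next
  case (weyl_reflection \<alpha>)
  then show ?case using root_reflection_word by blast
next
  case (weyl_comp v w)
  then show ?case by (metis reflection_word_append set_append Un_least)
next
  case (weyl_inv w)
  then show ?case by (metis inv_reflection_word set_rev)
qed

section \<open>Inversion parity and multiplicativity of the sign\<close>

text \<open>Integer valued, since 1 and -1 must stay distinct even when the coefficient field has
  characteristic 2.\<close>

definition root_sign :: "'a \<Rightarrow> int" where
  "root_sign \<beta> = (if \<beta> \<in> P then 1 else - 1)"

text \<open>
  The parity of the number of positive roots made negative; it shows that the parity of the
  length of a word in the simple reflections depends only on the element it represents.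
\<close>

definition inversion_sign :: "('a \<Rightarrow> 'a) \<Rightarrow> int" where
  "inversion_sign w = (\<Prod>\<beta>\<in>P. root_sign (w \<beta>))"

lemma root_sign_uminus: "\<beta> \<in> \<Phi> \<Longrightarrow> root_sign (- \<beta>) = - root_sign \<beta>"
  using positive_or_negative positive_not_negative by (auto simp: root_sign_def)

lemma inversion_sign_id: "inversion_sign id = 1"
  by (simp add: inversion_sign_def root_sign_def)

text \<open>A simple reflection permutes the positive roots other than \<alpha> and negates
  \<alpha>, so exactly one factor of the product changes sign.\<close>

lemma inversion_sign_simple:
  assumes \<alpha>: "\<alpha> \<in> \<pi>" and w: "linear w" "w ` \<Phi> \<subseteq> \<Phi>"
  shows "inversion_sign (w \<circ> root_reflection \<alpha>) = - inversion_sign w"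
proof -
  let ?s = "root_reflection \<alpha>"
  have \<alpha>P: "\<alpha> \<in> P" and \<alpha>\<Phi>: "\<alpha> \<in> \<Phi>" using simple_positive \<alpha> simple_subset by auto
  then have "\<alpha> \<noteq> 0" using root_system by (auto simp: root_system_def)
  then have s\<alpha>: "?s \<alpha> = - \<alpha>" by (simp add: root_reflection_def scaleR_2)
  have maps: "?s \<beta> \<in> P - {\<alpha>}" if "\<beta> \<in> P - {\<alpha>}" for \<beta>
  proof -
    have "?s \<beta> \<noteq> \<alpha>"
    proof
      assume "?s \<beta> = \<alpha>"
      then have "\<beta> = - \<alpha>" using s\<alpha> root_reflection_involution[of \<alpha> \<beta>] by simp
      then show False using that positive_not_negative[OF \<alpha>P] by simp
    qed
    then show ?thesis using simple_reflection_positive[OF \<alpha>] that by auto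
  qed
  have bij: "bij_betw ?s (P - {\<alpha>}) (P - {\<alpha>})"
    by (rule bij_betw_byWitness[of _ ?s])
       (use maps in \<open>auto simp: root_reflection_involution\<close>)
  have "inversion_sign (w \<circ> ?s) = root_sign (w (?s \<alpha>)) * (\<Prod>\<beta>\<in>P - {\<alpha>}. root_sign (w (?s \<beta>)))"
    unfolding inversion_sign_def using finite_positive \<alpha>P by (simp add: prod.remove)
  also have "(\<Prod>\<beta>\<in>P - {\<alpha>}. root_sign (w (?s \<beta>))) = (\<Prod>\<beta>\<in>P - {\<alpha>}. root_sign (w \<beta>))"
    by (rule prod.reindex_bij_betw[OF bij])
  also have "root_sign (w (?s \<alpha>)) = - root_sign (w \<alpha>)"
    using w \<alpha>\<Phi> by (simp add: s\<alpha> linear_neg root_sign_uminus image_subset_iff)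
  finally show ?thesis
    unfolding inversion_sign_def using finite_positive \<alpha>P by (simp add: prod.remove)
qed

lemma reflection_word_in_weyl_group: "set \<alpha>s \<subseteq> \<Phi> \<Longrightarrow> reflection_word \<alpha>s \<in> weyl_group \<Phi>"
  by (induction \<alpha>s) (auto intro: weyl_group.intros simp del: id_apply)

text \<open>Induction from the end of the word, because \<open>inversion_sign_simple\<close>
  multiplies by a simple reflection on the right.\<close>

lemma inversion_sign_word: "set \<alpha>s \<subseteq> \<pi> \<Longrightarrow> inversion_sign (reflection_word \<alpha>s) = (- 1) ^ length \<alpha>s"
proof (induction \<alpha>s rule: rev_induct)
  case (snoc \<alpha> \<alpha>s)
  then have "reflection_word \<alpha>s \<in> weyl_group \<Phi>"
    using reflection_word_in_weyl_group simple_subset by auto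
  then have "linear (reflection_word \<alpha>s)" "reflection_word \<alpha>s ` \<Phi> \<subseteq> \<Phi>"
    using orthogonal_transformation_weyl_group weyl_group_image[OF root_system]
    by (auto simp: orthogonal_transformation_def)
  then have "inversion_sign (reflection_word \<alpha>s \<circ> root_reflection \<alpha>)
      = - inversion_sign (reflection_word \<alpha>s)"
    using snoc.prems by (intro inversion_sign_simple) auto
  then show ?case
    using snoc by (simp add: reflection_word_append comp_def)
qed (simp add: inversion_sign_id)

text \<open>The given word and a shortest word for the same element have equal inversion sign, hence
  lengths of equal parity.\<close>

lemma weyl_sign_word:
  assumes "set \<alpha>s \<subseteq> \<pi>"
  shows "weyl_sign \<pi> (reflection_word \<alpha>s) = (- 1 :: 'k::field) ^ length \<alpha>s"
proof -
  obtain \<beta>s where \<beta>s: "length \<beta>s = weyl_length \<pi> (reflection_word \<alpha>s)" "set \<beta>s \<subseteq> \<pi>"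
      "reflection_word \<alpha>s = reflection_word \<beta>s"
    using LeastI_ex[of "\<lambda>n. \<exists>\<beta>s. length \<beta>s = n \<and> set \<beta>s \<subseteq> \<pi> \<and>
        reflection_word \<alpha>s = foldr (\<circ>) (map root_reflection \<beta>s) id"] assms
    unfolding weyl_length_def reflection_word_def by blast
  \<comment> \<open>The comparison is made over the integers, where the power of -1 determines the
    parity; only afterwards does it pass to the field.\<close>
  have "(- 1 :: int) ^ length \<beta>s = (- 1) ^ length \<alpha>s"
    using inversion_sign_word[OF assms] inversion_sign_word[OF \<beta>s(2)] \<beta>s(3) by simp
  then have "even (length \<beta>s) \<longleftrightarrow> even (length \<alpha>s)"
    by (metis neg_one_even_power neg_one_odd_power one_neq_neg_one)
  then show ?thesis
    unfolding weyl_sign_def \<beta>s(1)[symmetric] by (cases "even (length \<alpha>s)") auto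
qed

lemma weyl_sign_comp:
  assumes "v \<in> weyl_group \<Phi>" "w \<in> weyl_group \<Phi>"
  shows "weyl_sign \<pi> (v \<circ> w) = (weyl_sign \<pi> v * weyl_sign \<pi> w :: 'k::field)"
proof -
  obtain \<alpha>s \<beta>s where *: "set \<alpha>s \<subseteq> \<pi>" "v = reflection_word \<alpha>s" "set \<beta>s \<subseteq> \<pi>" "w = reflection_word \<beta>s"
    using weyl_group_word assms by meson
  then have "weyl_sign \<pi> (reflection_word (\<alpha>s @ \<beta>s)) = (weyl_sign \<pi> v * weyl_sign \<pi> w :: 'k)"
    by (simp add: weyl_sign_word power_add)
  then show ?thesis using * by (simp add: reflection_word_append)
qed

lemma weyl_sign_reflection: "\<beta> \<in> \<Phi> \<Longrightarrow> weyl_sign \<pi> (root_reflection \<beta>) = (- 1 :: 'k::field)"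
  using root_reflection_word[of \<beta>] by (auto simp: weyl_sign_word)

lemma weyl_sign_inv:
  "w \<in> weyl_group \<Phi> \<Longrightarrow> weyl_sign \<pi> (inv w) = (weyl_sign \<pi> w :: 'k::field)"
  using weyl_group_word[of w] by (auto simp: inv_reflection_word weyl_sign_word)

end

lemma weyl_sign_square: "weyl_sign \<pi> w * weyl_sign \<pi> w = (1 :: 'k::field)"
  by (simp add: weyl_sign_def flip: power_mult_distrib)

section \<open>Quotient modules\<close>

text \<open>\<open>is_submodule\<close> does not list additive inverses among its closure
  conditions, so they enter as a separate premise.\<close>

lemma is_module_restrict:
  assumes M: "is_module G M" and U: "is_submodule G U M"
    and inverse: "\<And>x. x \<in> U \<Longrightarrow> \<exists>y\<in>U. madd M x y = mzero M"
  shows "is_module G (restrict_module M U)"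
proof -
  have ops: "madd (restrict_module M U) = madd M" "mzero (restrict_module M U) = mzero M"
    "msmult (restrict_module M U) = msmult M" "mact (restrict_module M U) = mact M"
    "mcarrier (restrict_module M U) = U"
    by (simp_all add: restrict_module_def)
  show ?thesis
    using M U inverse unfolding is_module_def is_submodule_def ops
    by (intro conjI ballI allI) (meson subsetD)+
qed

lemma is_module_mact: "is_module G M \<Longrightarrow> g \<in> G \<Longrightarrow> x \<in> mcarrier M \<Longrightarrow> mact M g x \<in> mcarrier M"
  by (simp add: is_module_def)

text \<open>Addition is tied to the type class operation so that cosets can be handled by
  differences. \<open>right_inverse\<close> serves to show that each g maps \<open>N\<close> onto
  itself.\<close>

locale additive_kg_module =
  fixes G :: "('a \<Rightarrow> 'a) set" and M :: "('k::field, 'a, 'm::ab_group_add) kg_module" and N :: "'m set"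
  assumes module: "is_module G M" and submodule: "is_submodule G N M"
    and madd: "madd M = (+)" and mzero: "mzero M = 0"
    and id_mem: "id \<in> G" and comp_mem: "g \<in> G \<Longrightarrow> h \<in> G \<Longrightarrow> g \<circ> h \<in> G"
    and right_inverse: "g \<in> G \<Longrightarrow> \<exists>h\<in>G. g \<circ> h = id"
begin

abbreviation "C \<equiv> module_coset M N"
abbreviation "Q \<equiv> quotient_module M N"

lemma closed:
  "0 \<in> mcarrier M"
  "x \<in> mcarrier M \<Longrightarrow> y \<in> mcarrier M \<Longrightarrow> x + y \<in> mcarrier M"
  "x \<in> mcarrier M \<Longrightarrow> msmult M c x \<in> mcarrier M"
  "x \<in> mcarrier M \<Longrightarrow> g \<in> G \<Longrightarrow> mact M g x \<in> mcarrier M"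
  using module by (simp_all add: is_module_def madd mzero)

lemma linear_ops:
  "x \<in> mcarrier M \<Longrightarrow> y \<in> mcarrier M \<Longrightarrow> msmult M c (x + y) = msmult M c x + msmult M c y"
  "x \<in> mcarrier M \<Longrightarrow> msmult M (c + d) x = msmult M c x + msmult M d x"
  "x \<in> mcarrier M \<Longrightarrow> msmult M (c * d) x = msmult M c (msmult M d x)"
  "x \<in> mcarrier M \<Longrightarrow> msmult M 1 x = x"
  "x \<in> mcarrier M \<Longrightarrow> y \<in> mcarrier M \<Longrightarrow> g \<in> G \<Longrightarrow> mact M g (x + y) = mact M g x + mact M g y"
  "x \<in> mcarrier M \<Longrightarrow> g \<in> G \<Longrightarrow> mact M g (msmult M c x) = msmult M c (mact M g x)"
  "x \<in> mcarrier M \<Longrightarrow> g \<in> G \<Longrightarrow> h \<in> G \<Longrightarrow> mact M (g \<circ> h) x = mact M g (mact M h x)"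
  "x \<in> mcarrier M \<Longrightarrow> mact M id x = x"
  using module unfolding is_module_def madd mzero by blast+

lemma submodule_closed:
  "n \<in> N \<Longrightarrow> n \<in> mcarrier M"
  "0 \<in> N"
  "n \<in> N \<Longrightarrow> n' \<in> N \<Longrightarrow> n + n' \<in> N"
  "n \<in> N \<Longrightarrow> msmult M c n \<in> N"
  "n \<in> N \<Longrightarrow> g \<in> G \<Longrightarrow> mact M g n \<in> N"
  using submodule unfolding is_submodule_def madd mzero by blast+

lemma msmult_minus_one: "x \<in> mcarrier M \<Longrightarrow> msmult M (- 1) x = - x"
proof -
  assume x: "x \<in> mcarrier M"
  have "msmult M 0 x = 0" using linear_ops(2)[OF x, of 0 0] by simp
  then show ?thesis
    using linear_ops(2)[OF x, of "- 1" 1] linear_ops(4)[OF x] by (simp add: eq_neg_iff_add_eq_0)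
qed

section \<open>Arithmetic of cosets\<close>

lemma coset_iff: "y \<in> C x \<longleftrightarrow> y - x \<in> N"
  by (auto simp: module_coset_def madd image_iff algebra_simps)
     (metis add.commute diff_add_cancel)

lemma coset_self: "n \<in> N \<Longrightarrow> C n = N"
proof (intro set_eqI iffI)
  fix y assume n: "n \<in> N"
  have "- n \<in> N"
    using submodule_closed(4)[OF n, of "- 1"] msmult_minus_one submodule_closed(1)[OF n] by simp
  then show "y \<in> C n" if "y \<in> N" using submodule_closed(3)[OF that, of "- n"] by (simp add: coset_iff)
  show "y \<in> N" if "y \<in> C n" using that submodule_closed(3)[OF _ n] by (force simp: coset_iff)
qed

lemma madd_coset: "madd Q (C x) (C y) = C (x + y)"
proof (intro set_eqI iffI)
  fix z assume "z \<in> madd Q (C x) (C y)"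
  then obtain a b where ab: "a - x \<in> N" "b - y \<in> N" "z = a + b"
    by (auto simp: quotient_module_def madd coset_iff)
  then show "z \<in> C (x + y)"
    using submodule_closed(3)[OF ab(1,2)] by (simp add: coset_iff algebra_simps)
next
  fix z assume "z \<in> C (x + y)"
  \<comment> \<open>Any splitting works; here the whole deviation from x + y is put into the first
    summand.\<close>
  then have "z - y \<in> C x" "y \<in> C y" by (simp_all add: coset_iff algebra_simps submodule_closed)
  then show "z \<in> madd Q (C x) (C y)"
    unfolding quotient_module_def by (force simp: madd)
qed

text \<open>Scaling sends the \<open>N\<close> part of a representative into \<open>N\<close>.
  Conversely x itself serves as representative, and the copy of \<open>N\<close> added in the
  definition supplies the rest, uniformly in c including c = 0.\<close>

lemma msmult_coset: "x \<in> mcarrier M \<Longrightarrow> msmult Q c (C x) = C (msmult M c x)"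
proof (intro set_eqI iffI)
  fix z assume x: "x \<in> mcarrier M" and "z \<in> msmult Q c (C x)"
  then obtain a n where an: "a \<in> N" "n \<in> N" "z = msmult M c (x + a) + n"
    by (auto simp: quotient_module_def madd module_coset_def)
  then show "z \<in> C (msmult M c x)"
    using submodule_closed x by (simp add: coset_iff linear_ops)
next
  fix z assume x: "x \<in> mcarrier M" and "z \<in> C (msmult M c x)"
  then obtain n where "n \<in> N" "z = msmult M c x + n" by (auto simp: module_coset_def madd)
  moreover have "x \<in> C x" by (simp add: coset_iff submodule_closed)
  ultimately show "z \<in> msmult Q c (C x)"
    unfolding quotient_module_def by (force simp: madd)
qed

lemma mact_coset: "x \<in> mcarrier M \<Longrightarrow> g \<in> G \<Longrightarrow> mact Q g (C x) = C (mact M g x)"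
proof (intro set_eqI iffI)
  fix z assume x: "x \<in> mcarrier M" and g: "g \<in> G" and "z \<in> mact Q g (C x)"
  then obtain n where "n \<in> N" "z = mact M g (x + n)"
    by (auto simp: quotient_module_def madd module_coset_def)
  then show "z \<in> C (mact M g x)"
    using submodule_closed x g by (simp add: coset_iff linear_ops)
next
  fix z assume x: "x \<in> mcarrier M" and g: "g \<in> G" and "z \<in> C (mact M g x)"
  then obtain n where n: "n \<in> N" "z = mact M g x + n" by (auto simp: module_coset_def madd)
  \<comment> \<open>The deviation n has to be pulled back through g, and its preimage under the
    action, \<open>mact M h n\<close>, again lies in \<open>N\<close>.\<close>
  obtain h where h: "h \<in> G" "g \<circ> h = id" using right_inverse[OF g] by blast
  have "mact M g (mact M h n) = n"
    using linear_ops(7)[OF submodule_closed(1)[OF n(1)] g h(1)] h(2)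
      linear_ops(8)[OF submodule_closed(1)[OF n(1)]] by simp
  then have "z = mact M g (x + mact M h n)"
    using n x g h submodule_closed by (simp add: linear_ops)
  moreover have "x + mact M h n \<in> C x"
    using submodule_closed(5) n(1) h(1) by (simp add: coset_iff)
  ultimately show "z \<in> mact Q g (C x)" by (auto simp: quotient_module_def)
qed

lemma quotient_carrier: "mcarrier Q = C ` mcarrier M" and quotient_zero: "mzero Q = C 0"
  using coset_self[OF submodule_closed(2)] by (simp_all add: quotient_module_def)

lemma is_module_quotient: "is_module G Q"
proof -
  have inverse: "\<exists>y\<in>mcarrier M. C (x + y) = C 0" if "x \<in> mcarrier M" for x
    using closed(3)[OF that, of "- 1"] msmult_minus_one[OF that] by (intro bexI[of _ "- x"]) simp_all
  show ?thesis
    unfolding is_module_def quotient_carrier quotient_zero ball_simps bex_simps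
    using inverse
    by (auto simp: madd_coset msmult_coset mact_coset linear_ops closed id_mem comp_mem add_ac
        simp del: comp_apply id_apply)
qed

text \<open>Correspondence of submodules: the preimage of \<open>U\<close> is a submodule of
  \<open>M\<close>. If it is everything, so is \<open>U\<close>; if it lies in \<open>N\<close>,
  then \<open>U\<close> is the zero coset alone.\<close>

lemma quotient_zero_or_irreducible:
  assumes "\<And>V. is_submodule G V M \<Longrightarrow> V = mcarrier M \<or> V \<subseteq> N"
  shows "zero_module G Q \<or> irreducible_module G Q"
proof (cases "mcarrier Q = {mzero Q}")
  case True
  then show ?thesis using is_module_quotient by (simp add: zero_module_def)
next
  case False
  have "U = {mzero Q} \<or> U = mcarrier Q" if U: "is_submodule G U Q" for U
  proof -
    define V where "V = {x \<in> mcarrier M. C x \<in> U}"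
    have U': "U \<subseteq> C ` mcarrier M" "C 0 \<in> U"
      "\<And>X Y. X \<in> U \<Longrightarrow> Y \<in> U \<Longrightarrow> madd Q X Y \<in> U" "\<And>c X. X \<in> U \<Longrightarrow> msmult Q c X \<in> U"
      "\<And>g X. g \<in> G \<Longrightarrow> X \<in> U \<Longrightarrow> mact Q g X \<in> U"
      using U by (auto simp: is_submodule_def quotient_carrier quotient_zero)
    have "x + y \<in> V" if "x \<in> V" "y \<in> V" for x y
      using that U'(3)[of "C x" "C y"] closed(2) by (simp add: V_def madd_coset)
    moreover have "msmult M c x \<in> V" if "x \<in> V" for c x
      using that U'(4)[of "C x" c] closed(3) by (simp add: V_def msmult_coset)
    moreover have "mact M g x \<in> V" if "g \<in> G" "x \<in> V" for g x
      using that U'(5)[of g "C x"] closed(4) by (simp add: V_def mact_coset)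
    moreover have "V \<subseteq> mcarrier M" "0 \<in> V" using U'(2) closed(1) by (auto simp: V_def)
    ultimately have "is_submodule G V M"
      unfolding is_submodule_def madd mzero by blast
    from assms[OF this] show ?thesis
    proof
      assume "V = mcarrier M"
      then show ?thesis using U'(1) by (auto simp: V_def quotient_carrier)
    next
      assume "V \<subseteq> N"
      then have "X = C 0" if "X \<in> U" for X
        using U'(1) that coset_self coset_self[OF submodule_closed(2)] by (fastforce simp: V_def)
      then have "U = {C 0}" using U'(2) by blast
      then show ?thesis by (simp add: quotient_zero)
    qed
  qed
  then show ?thesis using False is_module_quotient by (simp add: irreducible_module_def)
qed

end

section \<open>Action and form on the free module\<close>

lemma tableau_act_id [simp]: "tableau_act id t = t"
  by (cases t) (simp add: tableau_act_def)

lemma tabloid_act_id [simp]: "tabloid_act id T = T"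
  by (simp add: tabloid_act_def)

lemma tabloid_act_comp: "tabloid_act v (tabloid_act w T) = tabloid_act (v \<circ> w) T"
  by (simp add: tabloid_act_def image_image tableau_act_comp)

lemma tabloid_act_eq_iff: "bij \<sigma> \<Longrightarrow> tabloid_act \<sigma> T = T' \<longleftrightarrow> T = tabloid_act (inv \<sigma>) T'"
  by (metis tabloid_act_comp tabloid_act_id bij_is_inj bij_is_surj inv_o_cancel surj_iff)

lemma tabloid_act_inv_left: "bij \<sigma> \<Longrightarrow> tabloid_act (inv \<sigma>) (tabloid_act \<sigma> T) = T"
  and tabloid_act_inv_right: "bij \<sigma> \<Longrightarrow> tabloid_act \<sigma> (tabloid_act (inv \<sigma>) T) = T"
  using tabloid_act_eq_iff by metis+

text \<open>Each tabloid has exactly one preimage under a bijective \<sigma>, so pushing basis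
  vectors forward amounts to pulling coefficients back. The laws of the action can then be checked
  coefficientwise.\<close>

lemma lookup_free_act:
  assumes "bij \<sigma>"
  shows "Poly_Mapping.lookup (free_act \<sigma> m) T = Poly_Mapping.lookup m (tabloid_act (inv \<sigma>) T)"
proof -
  have "Poly_Mapping.lookup (free_act \<sigma> m) T =
      (\<Sum>T'\<in>Poly_Mapping.keys m. if T' = tabloid_act (inv \<sigma>) T then Poly_Mapping.lookup m T' else 0)"
    unfolding free_act_def lookup_sum
    by (intro sum.cong) (auto simp: lookup_single when_def tabloid_act_eq_iff[OF assms])
  also have "\<dots> = Poly_Mapping.lookup m (tabloid_act (inv \<sigma>) T)"
    by (simp add: sum.delta in_keys_iff)
  finally show ?thesis .
qed

lemma free_act_single: "free_act \<sigma> (Poly_Mapping.single T c) = Poly_Mapping.single (tabloid_act \<sigma> T) c"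
  by (cases "c = 0") (simp_all add: free_act_def)

lemma free_act_add: "bij \<sigma> \<Longrightarrow> free_act \<sigma> (m + m') = free_act \<sigma> m + free_act \<sigma> m'"
  by (rule poly_mapping_eqI) (simp add: lookup_free_act lookup_add)

lemma free_act_fscale: "bij \<sigma> \<Longrightarrow> free_act \<sigma> (fscale c m) = fscale c (free_act \<sigma> m)"
  by (rule poly_mapping_eqI) (simp add: lookup_free_act)

lemma free_act_zero [simp]: "free_act \<sigma> 0 = 0"
  by (simp add: free_act_def)

lemma free_act_id: "free_act id m = m"
  by (rule poly_mapping_eqI) (simp add: lookup_free_act)

lemma free_act_comp: "bij \<sigma> \<Longrightarrow> bij \<tau> \<Longrightarrow> free_act (\<sigma> \<circ> \<tau>) m = free_act \<sigma> (free_act \<tau> m)"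
  by (rule poly_mapping_eqI)
     (simp add: lookup_free_act bij_comp tabloid_act_comp o_inv_distrib del: comp_apply)

section \<open>Symmetry, bilinearity and invariance of the form\<close>

lemma tabloid_form_eq:
  "tabloid_form m m' = (\<Sum>T\<in>Poly_Mapping.keys m. Poly_Mapping.lookup m T * Poly_Mapping.lookup m' T)"
proof -
  have "(\<Sum>T'\<in>Poly_Mapping.keys m'. Poly_Mapping.lookup m T * Poly_Mapping.lookup m' T' *
      (if T = T' then 1 else 0)) = Poly_Mapping.lookup m T * Poly_Mapping.lookup m' T" for T
    by (simp add: if_distrib[of "\<lambda>x. _ * x"] in_keys_iff cong: if_cong)
  then show ?thesis by (simp add: tabloid_form_def)
qed

text \<open>Lets two vectors share one summation range, which makes the symmetry of the form
  visible.\<close>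

lemma tabloid_form_superset:
  assumes "finite A" "Poly_Mapping.keys m \<subseteq> A"
  shows "tabloid_form m m' = (\<Sum>T\<in>A. Poly_Mapping.lookup m T * Poly_Mapping.lookup m' T)"
  unfolding tabloid_form_eq by (rule sum.mono_neutral_left) (use assms in \<open>auto simp: in_keys_iff\<close>)

lemma tabloid_form_commute: "tabloid_form m m' = tabloid_form m' m"
  using tabloid_form_superset[of "Poly_Mapping.keys m \<union> Poly_Mapping.keys m'" m m']
    tabloid_form_superset[of "Poly_Mapping.keys m \<union> Poly_Mapping.keys m'" m' m]
  by (simp add: mult.commute)

lemma tabloid_form_zero_right [simp]: "tabloid_form m 0 = 0"
  and tabloid_form_add_right: "tabloid_form m (x + y) = tabloid_form m x + tabloid_form m y"
  and tabloid_form_fscale_right: "tabloid_form m (fscale c x) = c * tabloid_form m x"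
  by (simp_all add: tabloid_form_eq lookup_add distrib_left sum.distrib sum_distrib_left mult.left_commute)

lemma tabloid_form_zero_left [simp]: "tabloid_form 0 m = 0"
  and tabloid_form_add_left: "tabloid_form (x + y) m = tabloid_form x m + tabloid_form y m"
  and tabloid_form_fscale_left: "tabloid_form (fscale c x) m = c * tabloid_form x m"
  using tabloid_form_zero_right tabloid_form_add_right tabloid_form_fscale_right
  by (simp_all add: tabloid_form_commute[of _ m])

lemma tabloid_form_sum_right: "tabloid_form m (\<Sum>i\<in>I. f i) = (\<Sum>i\<in>I. tabloid_form m (f i))"
  by (induction I rule: infinite_finite_induct) (simp_all add: tabloid_form_add_right)

lemma tabloid_form_sum_left: "tabloid_form (\<Sum>i\<in>I. f i) m = (\<Sum>i\<in>I. tabloid_form (f i) m)"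
  by (simp add: tabloid_form_commute[of _ m] tabloid_form_sum_right)

text \<open>The action permutes an orthonormal basis, so the adjoint of \<sigma> is its
  inverse.\<close>

lemma tabloid_form_free_act:
  assumes "bij \<sigma>"
  shows "tabloid_form (free_act \<sigma> m) m' = tabloid_form m (free_act (inv \<sigma>) m')"
proof -
  have inv: "bij (inv \<sigma>)" "inv (inv \<sigma>) = \<sigma>"
    using assms by (simp_all add: bij_imp_bij_inv inv_inv_eq)
  have "bij_betw (tabloid_act \<sigma>) (Poly_Mapping.keys m) (Poly_Mapping.keys (free_act \<sigma> m))"
    by (rule bij_betw_byWitness[of _ "tabloid_act (inv \<sigma>)"])
       (auto simp: in_keys_iff lookup_free_act[OF assms]
         tabloid_act_inv_left[OF assms] tabloid_act_inv_right[OF assms])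
  then show ?thesis
    unfolding tabloid_form_eq
    by (subst sum.reindex_bij_betw[symmetric])
       (auto intro!: sum.cong simp: lookup_free_act assms inv tabloid_act_inv_left)
qed

section \<open>Tabloids and polytabloids\<close>

lemma weyl_group_inv_left: "w \<in> weyl_group \<Psi> \<Longrightarrow> inv w \<circ> w = id"
  and weyl_group_inv_right: "w \<in> weyl_group \<Psi> \<Longrightarrow> w \<circ> inv w = id"
  using weyl_group_bij[of w \<Psi>] by (auto simp: bij_is_inj bij_is_surj surj_iff[symmetric])

lemma weyl_normalizer_comp:
  "m \<in> weyl_normalizer \<Phi> \<Psi> \<Longrightarrow> n \<in> weyl_normalizer \<Phi> \<Psi> \<Longrightarrow> m \<circ> n \<in> weyl_normalizer \<Phi> \<Psi>"
  unfolding weyl_normalizer_def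
  by (metis (mono_tags, lifting) image_comp mem_Collect_eq weyl_group.weyl_comp)

lemma weyl_normalizer_inv: "n \<in> weyl_normalizer \<Phi> \<Psi> \<Longrightarrow> inv n \<in> weyl_normalizer \<Phi> \<Psi>"
  unfolding weyl_normalizer_def
  by (metis (mono_tags, lifting) mem_Collect_eq weyl_group.weyl_inv weyl_group_bij bij_is_inj image_inv_f_f)

lemma weyl_normalizer_conj:
  assumes "w \<in> weyl_group \<Phi>" "n \<in> weyl_normalizer \<Phi> \<Psi>"
  shows "w \<circ> n \<circ> inv w \<in> weyl_normalizer \<Phi> (w ` \<Psi>)"
proof -
  have n: "n \<in> weyl_group \<Phi>" "n ` \<Psi> = \<Psi>" using assms(2) by (auto simp: weyl_normalizer_def)
  have "inv w ` w ` \<Psi> = \<Psi>"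
    using weyl_group_bij[OF assms(1)] by (simp add: bij_is_inj image_inv_f_f)
  then have "(w \<circ> n \<circ> inv w) ` w ` \<Psi> = w ` \<Psi>"
    using n(2) by (metis image_comp)
  moreover have "w \<circ> n \<circ> inv w \<in> weyl_group \<Phi>"
    using assms(1) n(1) by (intro weyl_group.weyl_comp weyl_group.weyl_inv)
  ultimately show ?thesis unfolding weyl_normalizer_def by blast
qed

text \<open>Goodness involves the coefficient field and therefore enters as a premise of individual
  lemmas; the locale itself mentions no field.\<close>

locale subsystem_pair = based_root_system \<Phi> \<pi>
  for \<Phi> \<pi> :: "'a::euclidean_space set" +
  fixes \<Psi> J \<Psi>' :: "'a set" and Js Js' :: "'a set list"
  assumes subsystem: "subsystem \<Psi> \<Phi>" and subsystem': "subsystem \<Psi>' \<Phi>"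
    and simple_J: "simple_system J \<Psi>" and J_eq: "J = \<Union>(set Js)"
begin

abbreviation "W \<equiv> weyl_group \<Phi>"
abbreviation "W' \<equiv> weyl_group \<Psi>'"
abbreviation "N\<^sub>\<Psi> \<equiv> weyl_normalizer \<Phi> \<Psi>"

definition tab :: "('a \<Rightarrow> 'a) \<Rightarrow> 'a tabloid" where
  "tab w = tabloid \<Phi> \<Psi> (Js, Js') (tableau_act w (Js, Js'))"

abbreviation polytab :: "'a tabloid \<Rightarrow>\<^sub>0 'k::field" where
  "polytab \<equiv> polytabloid \<Phi> \<pi> \<Psi> \<Psi>' (Js, Js')"

lemma W'_subset: "w \<in> W' \<Longrightarrow> w \<in> W"
  using subsystem' weyl_group_mono by (auto simp: subsystem_def)

text \<open>
  A tableau \<open>w J\<close> determines \<open>w \<Psi>\<close>, since \<open>J\<close> generates \<open>\<Psi>\<close>; hence row equivalence does not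
  depend on the representative \<open>w\<close>.
\<close>

lemma tableau_determines_subsystem:
  assumes "v \<in> W" "w \<in> W" "tableau_act v (Js, Js') = tableau_act w (Js, Js')"
  shows "v ` \<Psi> = w ` \<Psi>"
proof -
  \<comment> \<open>With J as simple system of \<Psi>, the map \<open>inv w \<circ> v\<close>
    stabilises J and hence \<Psi>.\<close>
  interpret sub: based_root_system \<Psi> J
    using subsystem simple_J by unfold_locales (auto simp: subsystem_def)
  have "map ((`) v) Js = map ((`) w) Js" using assms(3) by (simp add: tableau_act_def)
  then have "\<Union>(set (map ((`) v) Js)) = \<Union>(set (map ((`) w) Js))" by (rule arg_cong)
  then have eq: "v ` J = w ` J" by (auto simp: J_eq image_Union)
  have "(inv w \<circ> v) ` J = inv w ` w ` J" by (simp only: image_comp[symmetric] eq)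
  also have "\<dots> = J" using weyl_group_bij[OF assms(2)] by (simp add: bij_is_inj image_inv_f_f)
  finally have "(inv w \<circ> v) ` J = J" .
  moreover have "orthogonal_transformation (inv w \<circ> v)"
    using assms by (intro orthogonal_transformation_weyl_group[of _ \<Phi>] weyl_group.intros)
  ultimately have "(inv w \<circ> v) ` \<Psi> = \<Psi>"
    using sub.orthogonal_transformation_preserves_root_system by blast
  then have "(w \<circ> (inv w \<circ> v)) ` \<Psi> = w ` \<Psi>" by (simp only: image_comp[symmetric])
  then show ?thesis
    using weyl_group_inv_right[OF assms(2)] by (simp only: comp_assoc[symmetric] id_comp)
qed

text \<open>An element u normalising w \<Psi> corresponds to n =
  \<open>inv w \<circ> u \<circ> w\<close> normalising \<Psi>. A tabloid is thereby the image of the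
  left coset of w, even if the definition reached it through another representative v.\<close>

lemma tab_eq:
  assumes w: "w \<in> W"
  shows "tab w = (\<lambda>n. tableau_act (w \<circ> n) (Js, Js')) ` N\<^sub>\<Psi>"
proof (intro set_eqI iffI)
  fix t assume "t \<in> tab w"
  then obtain v u where *: "v \<in> W" "u \<in> weyl_normalizer \<Phi> (v ` \<Psi>)"
      "tableau_act w (Js, Js') = tableau_act v (Js, Js')" "t = tableau_act u (tableau_act v (Js, Js'))"
    unfolding tab_def tabloid_def row_equiv_def by auto
  have "v ` \<Psi> = w ` \<Psi>" using tableau_determines_subsystem *(1,3) w by metis
  then have u: "u \<in> weyl_normalizer \<Phi> (w ` \<Psi>)" using *(2) by simp
  define n where "n = inv w \<circ> u \<circ> w"
  have "inv w ` w ` \<Psi> = \<Psi>" "inv (inv w) = w"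
    using weyl_group_bij[OF w] by (simp_all add: bij_is_inj image_inv_f_f inv_inv_eq)
  then have "n \<in> N\<^sub>\<Psi>"
    using weyl_normalizer_conj[OF weyl_group.weyl_inv[OF w] u] by (simp only: n_def)
  moreover have "w \<circ> n = u \<circ> w"
    unfolding n_def using weyl_group_inv_right[OF w] by (simp only: comp_assoc[symmetric] id_comp)
  then have "t = tableau_act (w \<circ> n) (Js, Js')" using *(3,4) by (simp add: tableau_act_comp[symmetric])
  ultimately show "t \<in> (\<lambda>n. tableau_act (w \<circ> n) (Js, Js')) ` N\<^sub>\<Psi>" by blast
next
  fix t assume "t \<in> (\<lambda>n. tableau_act (w \<circ> n) (Js, Js')) ` N\<^sub>\<Psi>"
  then obtain n where n: "n \<in> N\<^sub>\<Psi>" "t = tableau_act (w \<circ> n) (Js, Js')" by blast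
  have "w \<circ> n \<in> W" using n(1) w by (auto simp: weyl_normalizer_def intro: weyl_group.intros)
  moreover have "w \<circ> n = (w \<circ> n \<circ> inv w) \<circ> w"
    using weyl_group_inv_left[OF w] by (simp only: comp_assoc comp_id)
  then have "tableau_act (w \<circ> n) (Js, Js') = tableau_act (w \<circ> n \<circ> inv w) (tableau_act w (Js, Js'))"
    by (simp only: tableau_act_comp)
  ultimately have "(tableau_act w (Js, Js'), tableau_act (w \<circ> n) (Js, Js')) \<in> row_equiv \<Phi> \<Psi> (Js, Js')"
    using weyl_normalizer_conj[OF w n(1)] w unfolding row_equiv_def by blast
  then show "t \<in> tab w" by (simp only: tab_def tabloid_def Image_singleton_iff n(2))
qed

text \<open>Left multiplication by n permutes \<open>N\<^sub>\<Psi>\<close>, so w and w n describe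
  the same coset.\<close>

lemma tab_comp_normalizer:
  assumes w: "w \<in> W" and n: "n \<in> N\<^sub>\<Psi>"
  shows "tab (w \<circ> n) = tab w"
proof -
  have nW: "n \<in> W" using n by (simp add: weyl_normalizer_def)
  have "(\<circ>) n ` N\<^sub>\<Psi> = N\<^sub>\<Psi>"
  proof (intro subset_antisym image_subsetI subsetI)
    fix m assume m: "m \<in> N\<^sub>\<Psi>"
    then show "n \<circ> m \<in> N\<^sub>\<Psi>" using n by (rule weyl_normalizer_comp[rotated])
    have "m = n \<circ> (inv n \<circ> m)"
      using weyl_group_inv_right[OF nW] by (simp only: comp_assoc[symmetric] id_comp)
    then show "m \<in> (\<circ>) n ` N\<^sub>\<Psi>"
      using weyl_normalizer_comp[OF weyl_normalizer_inv[OF n] m] by (rule image_eqI)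
  qed
  then have "(\<lambda>m. tableau_act (w \<circ> m) (Js, Js')) ` N\<^sub>\<Psi>
      = (\<lambda>m. tableau_act (w \<circ> m) (Js, Js')) ` ((\<circ>) n ` N\<^sub>\<Psi>)" by (simp only:)
  also have "\<dots> = (\<lambda>m. tableau_act (w \<circ> n \<circ> m) (Js, Js')) ` N\<^sub>\<Psi>"
    by (simp only: image_image comp_assoc)
  finally show ?thesis using tab_eq[OF w] tab_eq[OF weyl_group.weyl_comp[OF w nW]] by (simp only:)
qed

lemma tabloids_eq: "tabloids \<Phi> \<Psi> (Js, Js') = tab ` W"
  by (auto simp: tabloids_def quotient_def tableaux_def tab_def tabloid_def)

lemma tabloid_act_tab: "\<sigma> \<in> W \<Longrightarrow> w \<in> W \<Longrightarrow> tabloid_act \<sigma> (tab w) = tab (\<sigma> \<circ> w)"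
  unfolding tab_def by (rule tabloid_act_tabloid)

lemma polytab_eq: "polytab = kappa \<pi> \<Psi>' (Poly_Mapping.single (tab id) 1)"
  by (simp only: polytabloid_def tab_def tableau_act_id)

section \<open>The signed column sum: linearity, adjointness and values on tabloids\<close>

lemma kappa_add: "kappa \<pi> \<Psi>' (x + y) = kappa \<pi> \<Psi>' x + kappa \<pi> \<Psi>' y"
proof -
  have "fscale (weyl_sign \<pi> \<sigma>) (free_act \<sigma> (x + y)) =
      fscale (weyl_sign \<pi> \<sigma>) (free_act \<sigma> x) + fscale (weyl_sign \<pi> \<sigma>) (free_act \<sigma> y)"
    if "\<sigma> \<in> W'" for \<sigma>
    using weyl_group_bij[OF that] by (simp add: free_act_add free_vs.scale_right_distrib)
  then show ?thesis by (simp add: kappa_def sum.distrib)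
qed

lemma kappa_fscale: "kappa \<pi> \<Psi>' (fscale c x) = fscale c (kappa \<pi> \<Psi>' x)"
proof -
  have "fscale (weyl_sign \<pi> \<sigma>) (free_act \<sigma> (fscale c x)) =
      fscale c (fscale (weyl_sign \<pi> \<sigma>) (free_act \<sigma> x))"
    if "\<sigma> \<in> W'" for \<sigma>
    using weyl_group_bij[OF that] by (simp add: free_act_fscale mult.commute)
  then show ?thesis by (simp add: kappa_def free_vs.scale_sum_right)
qed

lemma kappa_sum: "kappa \<pi> \<Psi>' (\<Sum>i\<in>I. f i) = (\<Sum>i\<in>I. kappa \<pi> \<Psi>' (f i))"
proof (induction I rule: infinite_finite_induct)
  case empty
  show ?case by (simp add: kappa_def)
qed (simp_all add: kappa_add, simp add: kappa_def)

text \<open>Passing to adjoints inverts each group element. Inversion permutes \<open>W'\<close> and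
  preserves signs, so the sum is unchanged.\<close>

lemma kappa_adjoint: "tabloid_form (kappa \<pi> \<Psi>' x) y = tabloid_form x (kappa \<pi> \<Psi>' y)"
proof -
  have bij: "bij_betw inv W' W'"
    by (rule bij_betw_byWitness[of _ inv])
       (auto simp: weyl_group.weyl_inv weyl_group_bij inv_inv_eq)
  have "tabloid_form (kappa \<pi> \<Psi>' x) y
      = (\<Sum>\<sigma>\<in>W'. weyl_sign \<pi> \<sigma> * tabloid_form x (free_act (inv \<sigma>) y))"
    unfolding kappa_def tabloid_form_sum_left
    by (intro sum.cong) (auto simp: tabloid_form_fscale_left tabloid_form_free_act weyl_group_bij)
  also have "\<dots> = (\<Sum>\<sigma>\<in>W'. weyl_sign \<pi> (inv \<sigma>) * tabloid_form x (free_act (inv \<sigma>) y))"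
    by (intro sum.cong) (auto simp: weyl_sign_inv W'_subset)
  also have "\<dots> = (\<Sum>\<sigma>\<in>W'. weyl_sign \<pi> \<sigma> * tabloid_form x (free_act \<sigma> y))"
    by (rule sum.reindex_bij_betw[OF bij])
  finally show ?thesis
    by (simp add: kappa_def tabloid_form_sum_right tabloid_form_fscale_right)
qed

text \<open>
  The terms are paired by \<open>\<sigma> \<mapsto> \<sigma> \<tau>\<^sub>\<alpha>\<close>, split by the sign of \<open>\<sigma> \<alpha>\<close>, so that they cancel also
  in characteristic 2.
\<close>

lemma kappa_fixed_by_reflection:
  fixes x :: "'a tabloid \<Rightarrow>\<^sub>0 'k::field"
  assumes \<alpha>: "\<alpha> \<in> \<Psi>'" and fixed: "free_act (root_reflection \<alpha>) x = x"
  shows "kappa \<pi> \<Psi>' x = 0"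
\<comment> \<open>For infinite \<open>W'\<close> the defining sum is 0 by convention; the pairing
  treats the finite case.\<close>
proof (cases "finite W'")
  case True
  let ?s = "root_reflection \<alpha>"
  let ?f = "\<lambda>\<sigma>. fscale (weyl_sign \<pi> \<sigma>) (free_act \<sigma> x)"
  define A where "A = {\<sigma> \<in> W'. \<sigma> \<alpha> \<in> P}"
  have \<alpha>\<Phi>: "\<alpha> \<in> \<Phi>" using \<alpha> subsystem' by (auto simp: subsystem_def)
  then have "\<alpha> \<noteq> 0" using root_system by (auto simp: root_system_def)
  then have s\<alpha>: "?s \<alpha> = - \<alpha>" by (simp add: root_reflection_def scaleR_2)
  have s: "?s \<in> W'" using \<alpha> by (rule weyl_group.weyl_reflection)
  have neg: "(\<sigma> \<circ> ?s) \<alpha> = - \<sigma> \<alpha>" and \<sigma>\<alpha>: "\<sigma> \<alpha> \<in> \<Phi>" if "\<sigma> \<in> W'" for \<sigma>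
  proof -
    show "(\<sigma> \<circ> ?s) \<alpha> = - \<sigma> \<alpha>"
      using orthogonal_transformation_weyl_group[OF that]
      by (simp add: s\<alpha> orthogonal_transformation_def linear_neg)
    show "\<sigma> \<alpha> \<in> \<Phi>" using weyl_group_image[OF root_system W'_subset[OF that]] \<alpha>\<Phi> by blast
  qed
  have ss: "\<sigma> \<circ> ?s \<circ> ?s = \<sigma>" for \<sigma> :: "'a \<Rightarrow> 'a"
    by (simp add: fun_eq_iff root_reflection_involution)
  have bij: "bij_betw (\<lambda>\<sigma>. \<sigma> \<circ> ?s) A (W' - A)"
  proof (rule bij_betw_byWitness[of _ "\<lambda>\<sigma>. \<sigma> \<circ> ?s"])
    show "\<forall>\<sigma>\<in>A. \<sigma> \<circ> ?s \<circ> ?s = \<sigma>" "\<forall>\<sigma>\<in>W' - A. \<sigma> \<circ> ?s \<circ> ?s = \<sigma>"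
      by (intro ballI ss)+
    show "(\<lambda>\<sigma>. \<sigma> \<circ> ?s) ` A \<subseteq> W' - A"
    proof (rule image_subsetI)
      fix \<sigma> assume "\<sigma> \<in> A"
      then have "\<sigma> \<in> W'" "\<sigma> \<alpha> \<in> P" by (auto simp: A_def)
      then show "\<sigma> \<circ> ?s \<in> W' - A"
        using positive_not_negative neg[of \<sigma>] weyl_group.weyl_comp[OF _ s, of \<sigma>]
        unfolding A_def by auto
    qed
    show "(\<lambda>\<sigma>. \<sigma> \<circ> ?s) ` (W' - A) \<subseteq> A"
    proof (rule image_subsetI)
      fix \<sigma> assume "\<sigma> \<in> W' - A"
      then have "\<sigma> \<in> W'" "\<sigma> \<alpha> \<notin> P" by (auto simp: A_def)
      then show "\<sigma> \<circ> ?s \<in> A"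
        using positive_or_negative[OF \<sigma>\<alpha>] neg[of \<sigma>] weyl_group.weyl_comp[OF _ s, of \<sigma>]
        unfolding A_def by auto
    qed
  qed
  have f: "?f (\<sigma> \<circ> ?s) = - ?f \<sigma>" if "\<sigma> \<in> W'" for \<sigma>
  proof -
    have "weyl_sign \<pi> (\<sigma> \<circ> ?s) = - (weyl_sign \<pi> \<sigma> :: 'k)"
      by (simp only: weyl_sign_comp[OF W'_subset[OF that] W'_subset[OF s]]
          weyl_sign_reflection[OF \<alpha>\<Phi>] mult_minus_right mult_1_right)
    moreover have "free_act (\<sigma> \<circ> ?s) x = free_act \<sigma> x"
      by (simp only: free_act_comp[OF weyl_group_bij[OF that] weyl_group_bij[OF s]] fixed)
    ultimately show ?thesis by simp
  qed
  have "kappa \<pi> \<Psi>' x = sum ?f A + sum ?f (W' - A)"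
    unfolding kappa_def using True by (subst sum.subset_diff[of A]) (auto simp: A_def add.commute)
  also have "sum ?f (W' - A) = (\<Sum>\<sigma>\<in>A. ?f (\<sigma> \<circ> ?s))"
    by (rule sum.reindex_bij_betw[OF bij, symmetric])
  also have "\<dots> = (\<Sum>\<sigma>\<in>A. - ?f \<sigma>)"
    by (rule sum.cong[OF refl], rule f) (simp add: A_def)
  finally show ?thesis by (simp add: sum_negf)
qed (simp add: kappa_def)

text \<open>Right translation by \<sigma> reindexes the sum over \<open>W'\<close>. The sign left
  over is that of \<sigma>, because its square is 1.\<close>

lemma kappa_tab_column:
  assumes \<sigma>: "\<sigma> \<in> W'"
  shows "kappa \<pi> \<Psi>' (Poly_Mapping.single (tab \<sigma>) 1) = fscale (weyl_sign \<pi> \<sigma>) (polytab :: _ \<Rightarrow>\<^sub>0 'k::field)"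
proof -
  let ?e = "Poly_Mapping.single (tab id) (1::'k)"
  have inv: "inv \<sigma> \<in> W'" using \<sigma> by (rule weyl_group.weyl_inv)
  have bij: "bij_betw (\<lambda>\<rho>. \<rho> \<circ> \<sigma>) W' W'"
  proof (rule bij_betw_byWitness[of _ "\<lambda>\<rho>. \<rho> \<circ> inv \<sigma>"])
    show "\<forall>\<rho>\<in>W'. \<rho> \<circ> \<sigma> \<circ> inv \<sigma> = \<rho>" "\<forall>\<rho>\<in>W'. \<rho> \<circ> inv \<sigma> \<circ> \<sigma> = \<rho>"
      using weyl_group_inv_left[OF \<sigma>] weyl_group_inv_right[OF \<sigma>]
      by (intro ballI, simp only: comp_assoc comp_id)+
    show "(\<lambda>\<rho>. \<rho> \<circ> \<sigma>) ` W' \<subseteq> W'" "(\<lambda>\<rho>. \<rho> \<circ> inv \<sigma>) ` W' \<subseteq> W'"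
      using \<sigma> inv weyl_group.weyl_comp by blast+
  qed
  have tab: "Poly_Mapping.single (tab \<sigma>) 1 = free_act \<sigma> ?e"
    using tabloid_act_tab[OF W'_subset[OF \<sigma>] weyl_group.weyl_one] by (simp add: free_act_single)
  have summand: "fscale (weyl_sign \<pi> \<rho>) (free_act \<rho> (free_act \<sigma> ?e))
      = fscale (weyl_sign \<pi> \<sigma>) (fscale (weyl_sign \<pi> (\<rho> \<circ> \<sigma>)) (free_act (\<rho> \<circ> \<sigma>) ?e))"
    if "\<rho> \<in> W'" for \<rho>
  proof -
    have "weyl_sign \<pi> \<sigma> * weyl_sign \<pi> (\<rho> \<circ> \<sigma>) = (weyl_sign \<pi> \<rho> * (weyl_sign \<pi> \<sigma> * weyl_sign \<pi> \<sigma>) :: 'k)"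
      by (simp only: weyl_sign_comp[OF W'_subset[OF that] W'_subset[OF \<sigma>]] mult_ac)
    then show ?thesis
      using free_act_comp[OF weyl_group_bij[OF that] weyl_group_bij[OF \<sigma>], of ?e]
      by (simp only: free_vs.scale_scale weyl_sign_square mult_1_right)
  qed
  have "kappa \<pi> \<Psi>' (Poly_Mapping.single (tab \<sigma>) 1) = (\<Sum>\<rho>\<in>W'. fscale (weyl_sign \<pi> \<rho>) (free_act \<rho> (free_act \<sigma> ?e)))"
    by (simp only: kappa_def tab)
  also have "\<dots> = (\<Sum>\<rho>\<in>W'. fscale (weyl_sign \<pi> \<sigma>) (fscale (weyl_sign \<pi> (\<rho> \<circ> \<sigma>)) (free_act (\<rho> \<circ> \<sigma>) ?e)))"
    by (rule sum.cong[OF refl], rule summand)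
  also have "\<dots> = (\<Sum>\<rho>\<in>W'. fscale (weyl_sign \<pi> \<sigma>) (fscale (weyl_sign \<pi> \<rho>) (free_act \<rho> ?e)))"
    by (rule sum.reindex_bij_betw[OF bij])
  finally show ?thesis by (simp only: polytab_eq kappa_def free_vs.scale_sum_right)
qed

lemma kappa_tab:
  assumes w: "w \<in> W"
    and good: "w ` \<Psi> \<inter> \<Psi>' = {} \<Longrightarrow> Poly_Mapping.lookup polytab (tab w) \<noteq> (0::'k::field)"
  shows "kappa \<pi> \<Psi>' (Poly_Mapping.single (tab w) 1) \<in> free_vs.span {polytab :: _ \<Rightarrow>\<^sub>0 'k}"
proof (cases "w ` \<Psi> \<inter> \<Psi>' = {}")
  case True
  \<comment> \<open>A non-zero coefficient forces a non-zero summand, and its \<sigma> carries the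
    base tabloid to \<open>tab w\<close>.\<close>
  have "(\<Sum>\<sigma>\<in>W'. Poly_Mapping.lookup (fscale (weyl_sign \<pi> \<sigma>)
      (free_act \<sigma> (Poly_Mapping.single (tab id) (1::'k)))) (tab w)) \<noteq> 0"
    using good[OF True] by (simp only: polytab_eq kappa_def lookup_sum simp_thms)
  then obtain \<sigma> where \<sigma>: "\<sigma> \<in> W'"
      and "Poly_Mapping.lookup (fscale (weyl_sign \<pi> \<sigma>)
        (free_act \<sigma> (Poly_Mapping.single (tab id) (1::'k)))) (tab w) \<noteq> 0"
    by (rule sum.not_neutral_contains_not_neutral)
  then have "tabloid_act \<sigma> (tab id) = tab w"
    by (auto simp: free_act_single lookup_single when_def split: if_splits)
  then have "tab w = tab \<sigma>"
    using tabloid_act_tab[OF W'_subset[OF \<sigma>] weyl_group.weyl_one] by simp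
  then show ?thesis
    by (simp add: kappa_tab_column[OF \<sigma>] free_vs.span_base free_vs.span_scale)
next
  case False
  then obtain \<beta> where \<beta>: "\<beta> \<in> \<Psi>" "w \<beta> \<in> \<Psi>'" by blast
  have \<Psi>: "\<Psi> \<subseteq> \<Phi>" "root_system \<Psi>" using subsystem by (auto simp: subsystem_def)
  then have "root_reflection \<beta> \<in> N\<^sub>\<Psi>"
    using \<beta>(1) by (auto simp: weyl_normalizer_def root_system_def intro: weyl_group.weyl_reflection)
  \<comment> \<open>The reflection in w \<beta> followed after w equals w after the reflection in
    \<beta>, and the latter normalises \<Psi>.\<close>
  then have "tab (root_reflection (w \<beta>) \<circ> w) = tab w"
    using tab_comp_normalizer[OF w] root_reflection_conj[OF orthogonal_transformation_weyl_group[OF w]]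
    by metis
  then have "free_act (root_reflection (w \<beta>)) (Poly_Mapping.single (tab w) (1::'k)) = Poly_Mapping.single (tab w) 1"
    using tabloid_act_tab[OF W'_subset w] weyl_group.weyl_reflection[OF \<beta>(2)]
    by (simp add: free_act_single)
  then have "kappa \<pi> \<Psi>' (Poly_Mapping.single (tab w) (1::'k)) = 0"
    by (rule kappa_fixed_by_reflection[OF \<beta>(2)])
  then show ?thesis by (simp add: free_vs.span_zero)
qed

text \<open>By linearity the claim reduces to the single tabloids in the support of m.\<close>

lemma kappa_in_span_polytab:
  fixes m :: "'a tabloid \<Rightarrow>\<^sub>0 'k::field"
  assumes good: "\<And>w. w \<in> W \<Longrightarrow> w ` \<Psi> \<inter> \<Psi>' = {} \<Longrightarrow> Poly_Mapping.lookup polytab (tab w) \<noteq> (0::'k)"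
    and m: "Poly_Mapping.keys m \<subseteq> tabloids \<Phi> \<Psi> (Js, Js')"
  shows "kappa \<pi> \<Psi>' m \<in> free_vs.span {polytab}"
proof -
  have "m = (\<Sum>T\<in>Poly_Mapping.keys m. fscale (Poly_Mapping.lookup m T) (Poly_Mapping.single T 1))"
    by (rule poly_mapping_eqI) (simp add: lookup_sum lookup_single when_def in_keys_iff if_distrib[of "\<lambda>x. _ * x"] cong: if_cong)
  then have "kappa \<pi> \<Psi>' m = (\<Sum>T\<in>Poly_Mapping.keys m.
      fscale (Poly_Mapping.lookup m T) (kappa \<pi> \<Psi>' (Poly_Mapping.single T 1)))"
    using kappa_sum kappa_fscale by (metis (no_types, lifting) sum.cong)
  also have "\<dots> \<in> free_vs.span {polytab}"
  proof (intro free_vs.span_sum free_vs.span_scale)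
    fix T assume "T \<in> Poly_Mapping.keys m"
    then obtain w where "w \<in> W" "T = tab w" using m tabloids_eq by blast
    then show "kappa \<pi> \<Psi>' (Poly_Mapping.single T 1) \<in> free_vs.span {polytab :: _ \<Rightarrow>\<^sub>0 'k}"
      using kappa_tab good by blast
  qed
  finally show ?thesis .
qed

section \<open>The submodule theorem\<close>

abbreviation S :: "('a tabloid \<Rightarrow>\<^sub>0 'k::field) set" where
  "S \<equiv> S_space \<Phi> \<pi> \<Psi> \<Psi>' (Js, Js')"
abbreviation S_orth :: "('a tabloid \<Rightarrow>\<^sub>0 'k::field) set" where
  "S_orth \<equiv> S_perp \<Phi> \<pi> \<Psi> \<Psi>' (Js, Js')"
abbreviation M :: "('k::field, 'a, 'a tabloid \<Rightarrow>\<^sub>0 'k) kg_module" where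
  "M \<equiv> M_module \<Phi> \<Psi> (Js, Js')"

section \<open>Module structure on M, on S and on its orthogonal complement\<close>

lemma is_module_M: "is_module W (M :: ('k::field, 'a, _) kg_module)"
proof -
  have act: "free_act g x \<in> mcarrier M" if "g \<in> W" "x \<in> mcarrier M"
    for g and x :: "'a tabloid \<Rightarrow>\<^sub>0 'k"
  proof -
    have "T \<in> tab ` W" if T: "T \<in> Poly_Mapping.keys (free_act g x)" for T
    proof -
      \<comment> \<open>A key of g x is the g-translate of a key of x, hence again a
        tabloid.\<close>
      have "tabloid_act (inv g) T \<in> Poly_Mapping.keys x"
        using T by (simp add: in_keys_iff lookup_free_act weyl_group_bij[OF \<open>g \<in> W\<close>])
      then obtain w where w: "w \<in> W" "tabloid_act (inv g) T = tab w"
        using \<open>x \<in> mcarrier M\<close> tabloids_eq by (auto simp: M_module_def)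
      then have "T = tab (g \<circ> w)"
        using tabloid_act_tab[OF \<open>g \<in> W\<close> w(1)] tabloid_act_inv_right[OF weyl_group_bij[OF \<open>g \<in> W\<close>], of T]
        by simp
      then show ?thesis using weyl_group.weyl_comp[OF \<open>g \<in> W\<close> w(1)] by blast
    qed
    then show ?thesis by (auto simp: M_module_def tabloids_eq)
  qed
  have add: "x + y \<in> mcarrier M" if "x \<in> mcarrier M" "y \<in> mcarrier M" for x y :: "'a tabloid \<Rightarrow>\<^sub>0 'k"
    using that keys_add[of x y] by (auto simp: M_module_def)
  have scale: "fscale c x \<in> mcarrier M" if "x \<in> mcarrier M" for c and x :: "'a tabloid \<Rightarrow>\<^sub>0 'k"
    using that by (auto simp: M_module_def in_keys_iff subset_iff)
  have inverse: "\<exists>y\<in>mcarrier M. x + y = 0" if "x \<in> mcarrier M" for x :: "'a tabloid \<Rightarrow>\<^sub>0 'k"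
    by (rule bexI[of _ "fscale (- 1) x"]) (simp, rule scale[OF that])
  show ?thesis
    unfolding is_module_def
    using act add scale inverse
    by (simp add: M_module_def free_act_add free_act_fscale free_act_id free_act_comp
        weyl_group_bij add.assoc add.commute free_vs.scale_right_distrib free_vs.scale_left_distrib)
qed

lemma polytab_in_M: "(polytab :: _ \<Rightarrow>\<^sub>0 'k::field) \<in> mcarrier M"
proof -
  have "T \<in> tab ` W" if T: "T \<in> Poly_Mapping.keys (polytab :: _ \<Rightarrow>\<^sub>0 'k)" for T
  proof -
    have "(\<Sum>\<sigma>\<in>W'. Poly_Mapping.lookup (fscale (weyl_sign \<pi> \<sigma>)
      (free_act \<sigma> (Poly_Mapping.single (tab id) (1::'k)))) T) \<noteq> 0"
      using T by (simp only: polytab_eq kappa_def lookup_sum in_keys_iff simp_thms)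
    then obtain \<sigma> where \<sigma>: "\<sigma> \<in> W'"
        and "Poly_Mapping.lookup (fscale (weyl_sign \<pi> \<sigma>)
          (free_act \<sigma> (Poly_Mapping.single (tab id) (1::'k)))) T \<noteq> 0"
      by (rule sum.not_neutral_contains_not_neutral)
    then have "T = tab \<sigma>"
      using tabloid_act_tab[OF W'_subset[OF \<sigma>] weyl_group.weyl_one]
      by (auto simp: free_act_single lookup_single when_def split: if_splits)
    then show ?thesis using W'_subset[OF \<sigma>] by blast
  qed
  then show ?thesis by (auto simp: M_module_def tabloids_eq)
qed

text \<open>The spanning set consists of all translates of one vector, so left multiplication
  carries it into itself.\<close>

lemma is_submodule_S: "is_submodule W S (M :: ('k::field, 'a, _) kg_module)"
proof -
  let ?B = "{free_act w (polytab :: _ \<Rightarrow>\<^sub>0 'k) | w. w \<in> W}"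
  have M: "is_module W (M :: ('k, 'a, _) kg_module)" by (rule is_module_M)
  then have subspace: "free_vs.subspace (mcarrier M :: ('a tabloid \<Rightarrow>\<^sub>0 'k) set)"
    unfolding free_vs.subspace_def is_module_def by (simp add: M_module_def)
  have "mact M w polytab \<in> mcarrier (M :: ('k, 'a, _) kg_module)" if "w \<in> W" for w
    by (rule is_module_mact[OF M that polytab_in_M])
  then have "?B \<subseteq> mcarrier M" by (auto simp: M_module_def)
  then have sub: "S \<subseteq> mcarrier (M :: ('k, 'a, _) kg_module)"
    unfolding S_space_def using subspace by (rule free_vs.span_minimal)
  have "free_act g x \<in> S" if g: "g \<in> W" and x: "x \<in> S" for g and x :: "'a tabloid \<Rightarrow>\<^sub>0 'k"
    using x unfolding S_space_def
  proof (induction rule: free_vs.span_induct_alt)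
    case base
    show ?case by (simp add: free_vs.span_zero)
  next
    case (step c y z)
    obtain w where w: "w \<in> W" "y = free_act w polytab" using step(1) by blast
    have "free_act g y = free_act (g \<circ> w) polytab"
      using free_act_comp[OF weyl_group_bij[OF g] weyl_group_bij[OF w(1)]] w(2) by metis
    then have "free_act g y \<in> ?B" using weyl_group.weyl_comp[OF g w(1)] by blast
    then show ?case
      using step(2) weyl_group_bij[OF g]
      by (simp add: free_act_add free_act_fscale free_vs.span_add free_vs.span_scale free_vs.span_base)
  qed
  then show ?thesis
    using sub unfolding is_submodule_def
    by (simp add: M_module_def S_space_def free_vs.span_zero free_vs.span_add free_vs.span_scale)
qed

text \<open>Moving g to the other side of the form turns it into its inverse, under which S is
  stable.\<close>

lemma is_submodule_S_perp: "is_submodule W S_orth (M :: ('k::field, 'a, _) kg_module)"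
proof -
  have S: "free_act g x \<in> S" if "g \<in> W" "x \<in> S" for g and x :: "'a tabloid \<Rightarrow>\<^sub>0 'k"
    using is_submodule_S that unfolding is_submodule_def by (auto simp: M_module_def)
  have M: "is_module W (M :: ('k, 'a, 'a tabloid \<Rightarrow>\<^sub>0 'k) kg_module)" by (rule is_module_M)
  have eq: "S_orth = {m \<in> mcarrier M. \<forall>x\<in>S. tabloid_form m (x :: _ \<Rightarrow>\<^sub>0 'k) = 0}"
    by (simp add: S_perp_def M_module_def)
  have ops: "madd M = (+)" "mzero M = 0" "msmult M = fscale" "mact M = (free_act :: _ \<Rightarrow> (_ \<Rightarrow>\<^sub>0 'k) \<Rightarrow> _)"
    by (simp_all add: M_module_def)
  show ?thesis
    using M S unfolding is_submodule_def is_module_def eq ops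
    by (auto simp: tabloid_form_add_left tabloid_form_fscale_left tabloid_form_free_act
        weyl_group_bij weyl_group.weyl_inv)
qed

text \<open>
  James' submodule theorem: if \<open>\<kappa> (w m) \<noteq> 0\<close> for some \<open>m \<in> U\<close> and \<open>w\<close>, then \<open>U\<close> contains a
  non-zero multiple of the polytabloid; otherwise \<open>U\<close> is orthogonal to all its translates.
\<close>

lemma submodule_theorem:
  fixes U :: "('a tabloid \<Rightarrow>\<^sub>0 'k::field) set"
  assumes good: "\<And>w. w \<in> W \<Longrightarrow> w ` \<Psi> \<inter> \<Psi>' = {} \<Longrightarrow> Poly_Mapping.lookup polytab (tab w) \<noteq> (0::'k)"
    and U: "is_submodule W U M"
  shows "S \<subseteq> U \<or> U \<subseteq> S_orth"
proof -
  have ops: "madd M = (+)" "mzero M = 0" "msmult M = fscale" "mact M = (free_act :: _ \<Rightarrow> (_ \<Rightarrow>\<^sub>0 'k) \<Rightarrow> _)"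
    "mcarrier M = {m :: _ \<Rightarrow>\<^sub>0 'k. Poly_Mapping.keys m \<subseteq> tabloids \<Phi> \<Psi> (Js, Js')}"
    by (simp_all add: M_module_def)
  have subspace: "free_vs.subspace U"
    and act: "\<And>g m. g \<in> W \<Longrightarrow> m \<in> U \<Longrightarrow> free_act g m \<in> U"
    and keys: "\<And>m. m \<in> U \<Longrightarrow> Poly_Mapping.keys m \<subseteq> tabloids \<Phi> \<Psi> (Js, Js')"
    using U unfolding is_submodule_def free_vs.subspace_def ops by blast+
  show ?thesis
  \<comment> \<open>Translates w m need no separate mention here, as \<open>U\<close> is stable
    under the group.\<close>
  proof (cases "\<exists>m\<in>U. kappa \<pi> \<Psi>' m \<noteq> 0")
    case True
    then obtain m where m: "m \<in> U" "kappa \<pi> \<Psi>' m \<noteq> 0" by blast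
    have "kappa \<pi> \<Psi>' m \<in> U" (is "?k \<in> _")
      unfolding kappa_def
      by (intro free_vs.subspace_sum free_vs.subspace_scale subspace act W'_subset m(1))
    obtain c where c: "kappa \<pi> \<Psi>' m = fscale c polytab"
      using kappa_in_span_polytab[OF good keys[OF m(1)]] by (auto simp: free_vs.span_singleton)
    have "c \<noteq> 0" using m(2) c by auto
    \<comment> \<open>Here the coefficients must form a field: c is non-zero and can be divided
      out.\<close>
    then have "polytab = fscale (1 / c) (kappa \<pi> \<Psi>' m)" using c by simp
    then have "polytab \<in> U" using free_vs.subspace_scale[OF subspace \<open>?k \<in> U\<close>] by metis
    then have "{free_act w (polytab :: _ \<Rightarrow>\<^sub>0 'k) | w. w \<in> W} \<subseteq> U" using act by auto
    then have "S \<subseteq> U" unfolding S_space_def using subspace by (rule free_vs.span_minimal)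
    then show ?thesis ..
  next
    case False
    have "tabloid_form m x = 0" if m: "m \<in> U" and x: "x \<in> S" for m x
      using x unfolding S_space_def
    proof (induction rule: free_vs.span_induct_alt)
      case (step c y z)
      obtain w where w: "w \<in> W" "y = free_act w polytab" using step(1) by blast
      have w': "inv w \<in> W" using w(1) by (rule weyl_group.weyl_inv)
      \<comment> \<open>First w and then \<open>kappa\<close> is moved to the left argument, where
        \<open>kappa\<close> vanishes on all of \<open>U\<close>.\<close>
      have "tabloid_form m y = tabloid_form (free_act (inv w) m) polytab"
        by (simp add: tabloid_form_free_act[OF weyl_group_bij[OF w']] w(2) inv_inv_eq weyl_group_bij[OF w(1)])
      also have "\<dots> = tabloid_form (kappa \<pi> \<Psi>' (free_act (inv w) m)) (Poly_Mapping.single (tab id) 1)"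
        by (simp only: polytab_eq kappa_adjoint)
      also have "\<dots> = 0" using False act[OF w' m] by simp
      finally show ?case using step(2) by (simp add: tabloid_form_add_right tabloid_form_fscale_right)
    qed simp
    then show ?thesis using keys by (auto simp: S_perp_def)
  qed
qed

end

theorem theorem3p16:
  fixes \<Phi> \<pi> \<Psi> J \<Psi>' J' :: "'a::euclidean_space set"
    and Js Js' :: "'a set list"
    and E :: "('a \<Rightarrow> 'a) set"
  assumes "root_system \<Phi>"
    and "simple_system \<pi> \<Phi>"
    and "ordered_simple_components \<Psi> J Js"
    and "ordered_simple_components \<Psi>' J' Js'"
    and "is_coset_set_E \<Phi> \<pi> \<Psi> J E"
    and "good_subsystem TYPE('k::field) \<Phi> \<pi> \<Psi> J \<Psi>' J' (Js, Js') E"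
  shows "zero_module (weyl_group \<Phi>)
           (D_module \<Phi> \<pi> \<Psi> \<Psi>' (Js, Js') :: ('k, 'a, ('a tabloid \<Rightarrow>\<^sub>0 'k) set) kg_module) \<or>
         irreducible_module (weyl_group \<Phi>)
           (D_module \<Phi> \<pi> \<Psi> \<Psi>' (Js, Js') :: ('k, 'a, ('a tabloid \<Rightarrow>\<^sub>0 'k) set) kg_module)"
proof -
  interpret subsystem_pair \<Phi> \<pi> \<Psi> J \<Psi>' Js Js'
    using assms unfolding good_subsystem_def useful_subsystem_def ordered_simple_components_def
    by unfold_locales auto
  have good: "Poly_Mapping.lookup polytab (tab w) \<noteq> (0::'k)" if w: "w \<in> W" "w ` \<Psi> \<inter> \<Psi>' = {}" for w
  proof -
    \<comment> \<open>Goodness speaks only of representatives in \<open>E\<close>. Passing from w to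
      w n alters neither the image of \<Psi> nor the tabloid, so it extends to all of
      \<open>W\<close>.\<close>
    obtain n where n: "n \<in> N\<^sub>\<Psi>" "w \<circ> n \<in> E"
      using assms(5) w(1) unfolding is_coset_set_E_def by blast
    have "(w \<circ> n) ` \<Psi> = w ` \<Psi>"
      using n(1) unfolding weyl_normalizer_def by (metis (mono_tags, lifting) image_comp mem_Collect_eq)
    then have "Poly_Mapping.lookup polytab (tab (w \<circ> n)) \<noteq> (0::'k)"
      using assms(6) n(2) w(2) unfolding good_subsystem_def tab_def by simp
    then show ?thesis using tab_comp_normalizer[OF w(1) n(1)] by simp
  qed
  let ?R = "restrict_module M S :: ('k, 'a, 'a tabloid \<Rightarrow>\<^sub>0 'k) kg_module"
  have ops: "madd ?R = madd M" "mzero ?R = mzero M" "msmult ?R = msmult M" "mact ?R = mact M" "mcarrier ?R = S"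
    by (simp_all add: restrict_module_def)
  have M: "is_module W (M :: ('k, 'a, 'a tabloid \<Rightarrow>\<^sub>0 'k) kg_module)" by (rule is_module_M)
  have sub_S: "is_submodule W S (M :: ('k, 'a, 'a tabloid \<Rightarrow>\<^sub>0 'k) kg_module)" by (rule is_submodule_S)
  have sub_P: "is_submodule W S_orth (M :: ('k, 'a, 'a tabloid \<Rightarrow>\<^sub>0 'k) kg_module)"
    by (rule is_submodule_S_perp)
  have inverse: "\<exists>y\<in>S. x + y = 0" if "x \<in> S" for x :: "'a tabloid \<Rightarrow>\<^sub>0 'k"
    using that by (intro bexI[of _ "- x"]) (simp_all add: S_space_def free_vs.span_neg)
  \<comment> \<open>The ambient module is now S itself, with the part of S orthogonal to S as the
    submodule divided out.\<close>
  interpret additive_kg_module W ?R "S \<inter> S_orth"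
  proof
    show "id \<in> W" "\<And>g h. g \<in> W \<Longrightarrow> h \<in> W \<Longrightarrow> g \<circ> h \<in> W" by (fact weyl_group.intros)+
    show "madd ?R = (+)" "mzero ?R = 0" by (simp_all add: restrict_module_def M_module_def)
    show "\<exists>h\<in>W. g \<circ> h = id" if "g \<in> W" for g
      using weyl_group_inv_right[OF that] weyl_group.weyl_inv[OF that] by blast
    show "is_submodule W (S \<inter> S_orth) ?R"
      using sub_S sub_P unfolding is_submodule_def ops by blast
    show "is_module W ?R"
      using M sub_S by (rule is_module_restrict) (use inverse in \<open>simp add: M_module_def\<close>)
  qed
  have "V = mcarrier ?R \<or> V \<subseteq> S \<inter> S_orth" if V: "is_submodule W V ?R" for V
  proof -
    \<comment> \<open>The submodule theorem is about submodules of M, so \<open>V\<close> is first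
      viewed there; containing S then means being equal to it.\<close>
    have "V \<subseteq> S" "is_submodule W V M"
      using V sub_S unfolding is_submodule_def ops by blast+
    then show ?thesis using submodule_theorem[OF good] by (auto simp: ops)
  qed
  then show ?thesis
    unfolding D_module_def by (rule quotient_zero_or_irreducible)
qed

end
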